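(* Let $X$ be a centered Gaussian random element with values in a separable Hilbert space $(H,\|\cdot\|_H)$, with infinite-dimensional support and Karhunen-Lo\`eve expansion $X=\sum_{i=1}^\infty\lambda_i^{1/2}\cdot Y_i\cdot e_i$, and let $\mu$ denote its distribution on $H$. Assume that $$\lim_{i\to\infty}\lambda_i\cdot i^\beta\cdot(\ln(i))^\alpha\in{]0,\infty[}$$ for some $\beta>1$ and $\alpha\in\mathbb{R}$. Then $$\operatorname{rbit}(\mu,p)\asymp\operatorname{quant}(\mu,p)\asymp p^{-(\beta-1)/2}\cdot(\ln(p+1))^{-\alpha/2}$$ uniformly in $p\in\mathbb{N}$. For $m\in\mathbb{N}$ define $\boldsymbol{p}(m)\in\mathbb{N}^m$ by $$p_i(m)=\lceil\max(\tilde p_i(m),1)\rceil,\qquad i=1,\dots,m,$$ where $$\tilde p_i(m)=\beta\cdot\log_2(m/i)+\max(\alpha,0)\cdot\log_2\bigl(\log_2(m+1)/\log_2(i+1)\bigr).$$ Then $$\left(\operatorname{E}\bigl\|X-X^{(m,\boldsymbol{p}(m))}\bigr\|_H^2\right)^{1/2}\asymp\operatorname{rbit}(\mu,|\boldsymbol{p}(m)|)$$ and $$|\boldsymbol{p}(m)|\asymp m,$$ both uniformly in $m\in\mathbb{N}$.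
   Context: $\mathbb{N}=\{1,2,\dots\}$. For functions $f,g\colon M\to[0,\infty]$ on a set $M$, $f(m)\preceq g(m)$ means that there is a constant $c>0$ with $f(m)\le c\,g(m)$ for every $m\in M$; $f\asymp g$ means $f\preceq g$ and $g\preceq f$. For a separable Banach space $(V,\|\cdot\|_V)$, $\mathfrak{M}(V)$ is the set of all Borel probability measures on $V$ with finite second moment, equipped with the Wasserstein distance of order two, $d(\mu_1,\mu_2)=\inf\{(\operatorname{E}\|X_1-X_2\|_V^2)^{1/2}\colon P_{X_1}=\mu_1,\ P_{X_2}=\mu_2\}$ ($X_1,X_2$ jointly defined on any probability space). For $p\in\mathbb{N}$, $\mathfrak{R}(V,p)\subseteq\mathfrak{M}(V)$ is the set of all image measures of the uniform distribution on $\{0,1\}^p$ under maps $f\colon\{0,1\}^p\to V$, and $\mathfrak{F}(V,p)=\{\nu\in\mathfrak{M}(V)\colon|\operatorname{supp}(\nu)|\le 2^p\}$. Put $\operatorname{rbit}(\mu,p)=\inf\{d(\mu,\nu)\colon\nu\in\mathfrak{R}(V,p)\}$ and $\operatorname{quant}(\mu,p)=\inf\{d(\mu,\nu)\colon\nu\in\mathfrak{F}(V,p)\}$. Here $V=H$. In the Karhunen-Lo\`eve expansion, $(e_i)_{i\in\mathbb{N}}$ is an orthonormal system in $H$, $(\lambda_i)_{i\in\mathbb{N}}$ is a non-increasing, summable sequence of strictly positive numbers, $Y_1,Y_2,\dots$ are independent standard normal random variables, and the series converges in mean-square with respect to $\|\cdot\|_H$. Approximation of a standard normal variable: $\Phi$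 is the standard normal distribution function; for $p\in\mathbb{N}$ and $x\in[0,1[$, $T^{(p)}(x)=\lfloor 2^p x\rfloor/2^p+2^{-(p+1)}$; for a standard normal random variable $Y$, $Y^{(p)}=\Phi^{-1}\circ T^{(p)}\circ\Phi(Y)$. For $m\in\mathbb{N}$ and $\boldsymbol{p}=(p_1,\dots,p_m)\in\mathbb{N}^m$, $X^{(m,\boldsymbol{p})}=\sum_{i=1}^m\lambda_i^{1/2}\cdot Y_i^{(p_i)}\cdot e_i$ and $|\boldsymbol{p}|=\sum_{i=1}^m p_i$. *)

theory Defs
  imports "HOL-Probability.Probability"
begin

definition second_moment_measures ::
    "'a::{banach, second_countable_topology} measure set" where
  "second_moment_measures =
     {\<mu>. sets \<mu> = sets borel \<and> prob_space \<mu> \<and> integrable \<mu> (\<lambda>x. (norm x)\<^sup>2)}"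

text \<open>
  All couplings are taken on sample spaces with underlying type \<open>'a \<times> 'a\<close>.  Only the joint law
  of the two variables matters, so this loses no generality; see \<open>coupling_costs_any_space\<close>.
\<close>

definition coupling_costs ::
    "'a::{banach, second_countable_topology} measure \<Rightarrow> 'a measure \<Rightarrow> real set" where
  "coupling_costs \<mu>1 \<mu>2 =
     {sqrt (\<integral>\<omega>. (norm (X1 \<omega> - X2 \<omega>))\<^sup>2 \<partial>N) | (N :: ('a \<times> 'a) measure) X1 X2.
        prob_space N \<and> X1 \<in> borel_measurable N \<and> X2 \<in> borel_measurable N \<and>
        distr N borel X1 = \<mu>1 \<and> distr N borel X2 = \<mu>2}"

definition wasserstein2 ::
    "'a::{banach, second_countable_topology} measure \<Rightarrow> 'a measure \<Rightarrow> real" where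
  "wasserstein2 \<mu>1 \<mu>2 = Inf (coupling_costs \<mu>1 \<mu>2)"

lemma coupling_costs_any_space:
  fixes X1 X2 :: "'w \<Rightarrow> 'a::{banach, second_countable_topology}"
  assumes "prob_space N" and [measurable]: "X1 \<in> borel_measurable N" "X2 \<in> borel_measurable N"
    and "distr N borel X1 = \<mu>1" "distr N borel X2 = \<mu>2"
  shows "sqrt (\<integral>\<omega>. (norm (X1 \<omega> - X2 \<omega>))\<^sup>2 \<partial>N) \<in> coupling_costs \<mu>1 \<mu>2"
proof -
  define J where "J = distr N (borel \<Otimes>\<^sub>M borel) (\<lambda>\<omega>. (X1 \<omega>, X2 \<omega>))"
  have "prob_space J"
    unfolding J_def by (intro prob_space.prob_space_distr assms(1)) measurable
  moreover have fst: "fst \<in> borel_measurable J" and snd: "snd \<in> borel_measurable J"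
    unfolding J_def by measurable
  moreover have "distr J borel fst = \<mu>1" "distr J borel snd = \<mu>2"
    unfolding J_def assms(4,5)[symmetric] by (subst distr_distr; simp add: comp_def)+
  moreover have "(\<integral>\<omega>. (norm (X1 \<omega> - X2 \<omega>))\<^sup>2 \<partial>N) = (\<integral>z. (norm (fst z - snd z))\<^sup>2 \<partial>J)"
    unfolding J_def by (subst integral_distr) simp_all
  ultimately show ?thesis
    unfolding coupling_costs_def
    by (intro CollectI exI[of _ J] exI[of _ fst] exI[of _ snd]) simp
qed

text \<open>
  For measures with finite second moment the Bochner integral and the real infimum in the
  Wasserstein distance take no default values.
\<close>

lemma integrable_coupling:
  fixes X1 X2 :: "'w \<Rightarrow> 'a::{banach, second_countable_topology}"
  assumes [measurable]: "X1 \<in> borel_measurable N" "X2 \<in> borel_measurable N"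
    and "distr N borel X1 \<in> second_moment_measures" "distr N borel X2 \<in> second_moment_measures"
  shows "integrable N (\<lambda>\<omega>. (norm (X1 \<omega> - X2 \<omega>))\<^sup>2)"
proof (rule Bochner_Integration.integrable_bound)
  have "integrable N (\<lambda>\<omega>. (norm (X1 \<omega>))\<^sup>2)" "integrable N (\<lambda>\<omega>. (norm (X2 \<omega>))\<^sup>2)"
    using assms(3,4) by (simp_all add: second_moment_measures_def integrable_distr_eq)
  then show "integrable N (\<lambda>\<omega>. 2 * (norm (X1 \<omega>))\<^sup>2 + 2 * (norm (X2 \<omega>))\<^sup>2)"
    by simp
  have "(norm (x - y))\<^sup>2 \<le> 2 * (norm x)\<^sup>2 + 2 * (norm y)\<^sup>2" for x y :: 'a
  proof -
    have "(norm (x - y))\<^sup>2 \<le> (norm x + norm y)\<^sup>2"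
      by (intro power_mono norm_triangle_ineq4) simp
    also have "\<dots> \<le> 2 * (norm x)\<^sup>2 + 2 * (norm y)\<^sup>2"
      using zero_le_power2[of "norm x - norm y"] by (simp add: power2_eq_square algebra_simps)
    finally show ?thesis .
  qed
  then show "AE \<omega> in N. norm ((norm (X1 \<omega> - X2 \<omega>))\<^sup>2)
      \<le> norm (2 * (norm (X1 \<omega>))\<^sup>2 + 2 * (norm (X2 \<omega>))\<^sup>2)"
    by simp
qed simp

lemma coupling_costs_nonempty:
  fixes \<mu>1 \<mu>2 :: "'a::{banach, second_countable_topology} measure"
  assumes "\<mu>1 \<in> second_moment_measures" "\<mu>2 \<in> second_moment_measures"
  shows "coupling_costs \<mu>1 \<mu>2 \<noteq> {}"
proof -
  have s [measurable_cong]: "sets \<mu>1 = sets borel" "sets \<mu>2 = sets borel"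
    and p: "prob_space \<mu>1" "prob_space \<mu>2"
    using assms by (auto simp: second_moment_measures_def)
  interpret P1: prob_space \<mu>1 by (rule p)
  interpret P2: prob_space \<mu>2 by (rule p)
  interpret P: pair_prob_space \<mu>1 \<mu>2 ..
  have sp: "space \<mu>1 = UNIV" "space \<mu>2 = UNIV"
    using s[THEN sets_eq_imp_space_eq] by simp_all
  have "distr (\<mu>1 \<Otimes>\<^sub>M \<mu>2) borel fst = \<mu>1"
  proof (rule measure_eqI)
    fix A assume "A \<in> sets (distr (\<mu>1 \<Otimes>\<^sub>M \<mu>2) borel fst)"
    then have A: "A \<in> sets borel" by simp
    have "fst -` A \<inter> space (\<mu>1 \<Otimes>\<^sub>M \<mu>2) = A \<times> UNIV"
      by (auto simp: space_pair_measure sp)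
    then show "emeasure (distr (\<mu>1 \<Otimes>\<^sub>M \<mu>2) borel fst) A = emeasure \<mu>1 A"
      using A s sp P2.emeasure_space_1
      by (simp add: emeasure_distr P2.emeasure_pair_measure_Times)
  qed (simp add: s)
  moreover have "distr (\<mu>1 \<Otimes>\<^sub>M \<mu>2) borel snd = \<mu>2"
  proof (rule measure_eqI)
    fix A assume "A \<in> sets (distr (\<mu>1 \<Otimes>\<^sub>M \<mu>2) borel snd)"
    then have A: "A \<in> sets borel" by simp
    have "snd -` A \<inter> space (\<mu>1 \<Otimes>\<^sub>M \<mu>2) = UNIV \<times> A"
      by (auto simp: space_pair_measure sp)
    then show "emeasure (distr (\<mu>1 \<Otimes>\<^sub>M \<mu>2) borel snd) A = emeasure \<mu>2 A"
      using A s sp P1.emeasure_space_1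
      by (simp add: emeasure_distr P2.emeasure_pair_measure_Times)
  qed (simp add: s)
  ultimately show ?thesis
    using coupling_costs_any_space[OF P.prob_space_axioms, of fst snd \<mu>1 \<mu>2]
    by (auto simp: measurable_fst'' measurable_snd'')
qed

lemma coupling_costs_bdd_below: "bdd_below (coupling_costs \<mu>1 \<mu>2)"
  by (rule bdd_belowI[of _ 0]) (auto simp: coupling_costs_def)

text \<open>The set \<open>{0,1}\<^sup>p\<close> is rendered as the extensional functions from \<open>{1..p}\<close> to \<open>{0,1}\<close>.\<close>

definition random_bit_measures ::
    "nat \<Rightarrow> 'a::{banach, second_countable_topology} measure set" where
  "random_bit_measures p =
     {distr (uniform_count_measure ({1..p} \<rightarrow>\<^sub>E {0, 1 :: nat})) borel f | f. True}"

lemma random_bit_measures_subset: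
  "random_bit_measures p \<subseteq>
     (second_moment_measures :: 'a::{banach, second_countable_topology} measure set)"
proof
  fix \<nu> :: "'a measure"
  define B where "B = {1..p} \<rightarrow>\<^sub>E {0, 1 :: nat}"
  assume "\<nu> \<in> random_bit_measures p"
  then obtain f where \<nu>: "\<nu> = distr (uniform_count_measure B) borel f"
    by (auto simp: random_bit_measures_def B_def)
  have B: "finite B" "B \<noteq> {}"
    by (auto simp: B_def PiE_eq_empty_iff intro!: finite_PiE)
  have f: "f \<in> borel_measurable (uniform_count_measure B)"
    by (simp add: measurable_def space_uniform_count_measure sets_uniform_count_measure)
  have "integrable (uniform_count_measure B) (\<lambda>x. (norm (f x))\<^sup>2)"
    unfolding uniform_count_measure_def by (rule integrable_point_measure_finite) (rule B)
  then show "\<nu> \<in> second_moment_measures"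
    using prob_space.prob_space_distr[OF prob_space_uniform_count_measure[OF B] f] f
    by (simp add: \<nu> second_moment_measures_def integrable_distr_eq)
qed

definition measure_support :: "'a::topological_space measure \<Rightarrow> 'a set" where
  "measure_support \<nu> = {x. \<forall>U. open U \<longrightarrow> x \<in> U \<longrightarrow> 0 < emeasure \<nu> U}"

definition finite_support_measures ::
    "nat \<Rightarrow> 'a::{banach, second_countable_topology} measure set" where
  "finite_support_measures p =
     {\<nu> \<in> second_moment_measures.
        finite (measure_support \<nu>) \<and> card (measure_support \<nu>) \<le> 2 ^ p}"

definition rbit :: "'a::{banach, second_countable_topology} measure \<Rightarrow> nat \<Rightarrow> real" where
  "rbit \<mu> p = (INF \<nu>\<in>random_bit_measures p. wasserstein2 \<mu> \<nu>)"

definition quant :: "'a::{banach, second_countable_topology} measure \<Rightarrow> nat \<Rightarrow> real" where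
  "quant \<mu> p = (INF \<nu>\<in>finite_support_measures p. wasserstein2 \<mu> \<nu>)"

text \<open>
  Real-valued functions suffice for this relation between nonnegative functions, since all
  quantities compared are finite.
\<close>

definition dominated_on :: "'m set \<Rightarrow> ('m \<Rightarrow> real) \<Rightarrow> ('m \<Rightarrow> real) \<Rightarrow> bool" where
  "dominated_on S f g \<longleftrightarrow> (\<exists>c>0. \<forall>m\<in>S. f m \<le> c * g m)"

definition weakly_equiv_on :: "'m set \<Rightarrow> ('m \<Rightarrow> real) \<Rightarrow> ('m \<Rightarrow> real) \<Rightarrow> bool" where
  "weakly_equiv_on S f g \<longleftrightarrow> dominated_on S f g \<and> dominated_on S g f"

text \<open>The case \<open>\<sigma> = 0\<close> is the degenerate normal distribution, the point mass at zero.\<close>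

definition centered_normal :: "real \<Rightarrow> real measure" where
  "centered_normal \<sigma> =
     (if \<sigma> = 0 then return borel 0 else density lborel (normal_density 0 \<sigma>))"

definition centered_gaussian_element ::
    "'w measure \<Rightarrow> ('w \<Rightarrow> 'a::{banach, second_countable_topology}) \<Rightarrow> bool" where
  "centered_gaussian_element M X \<longleftrightarrow>
     X \<in> borel_measurable M \<and>
     (\<forall>f :: 'a \<Rightarrow> real. bounded_linear f \<longrightarrow>
        (\<exists>\<sigma>\<ge>0. distr M borel (\<lambda>\<omega>. f (X \<omega>)) = centered_normal \<sigma>))"

definition infinite_dimensional :: "'a::real_vector set \<Rightarrow> bool" where
  "infinite_dimensional S \<longleftrightarrow> (\<nexists>B. finite B \<and> S \<subseteq> span B)"

definition std_normal_cdf :: "real \<Rightarrow> real" where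
  "std_normal_cdf = cdf std_normal_distribution"

definition cell_midpoint :: "nat \<Rightarrow> real \<Rightarrow> real" where
  "cell_midpoint p x = \<lfloor>2 ^ p * x\<rfloor> / 2 ^ p + 1 / 2 ^ (p + 1)"

text \<open>
  For \<open>p \<ge> 1\<close> and \<open>0 \<le> x < 1\<close> the value \<open>cell_midpoint p x\<close> lies in \<open>{0<..<1}\<close>, the range of the
  injective function \<open>std_normal_cdf\<close>, so \<open>inv\<close> is applied only where it is a genuine inverse.
\<close>

definition normal_approx :: "nat \<Rightarrow> real \<Rightarrow> real" where
  "normal_approx p = inv std_normal_cdf \<circ> cell_midpoint p \<circ> std_normal_cdf"

text \<open>
  Sequences indexed by the positive integers are functions on \<open>nat\<close> whose value at \<open>0\<close> is ignored;
  a vector of length \<open>m\<close> is such a function read on \<open>{1..m}\<close> only.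
\<close>

definition KL_approx ::
    "(nat \<Rightarrow> real) \<Rightarrow> (nat \<Rightarrow> 'w \<Rightarrow> real) \<Rightarrow> (nat \<Rightarrow> 'a::real_vector) \<Rightarrow>
     nat \<Rightarrow> (nat \<Rightarrow> nat) \<Rightarrow> 'w \<Rightarrow> 'a" where
  "KL_approx lam Y e m p \<omega> =
     (\<Sum>i=1..m. (sqrt (lam i) * normal_approx (p i) (Y i \<omega>)) *\<^sub>R e i)"

definition bit_budget :: "real \<Rightarrow> real \<Rightarrow> nat \<Rightarrow> nat \<Rightarrow> real" where
  "bit_budget \<alpha> \<beta> m i =
     \<beta> * log 2 (real m / real i)
     + max \<alpha> 0 * log 2 (log 2 (real m + 1) / log 2 (real i + 1))"

definition bit_number :: "real \<Rightarrow> real \<Rightarrow> nat \<Rightarrow> nat \<Rightarrow> nat" where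
  "bit_number \<alpha> \<beta> m i = nat \<lceil>max (bit_budget \<alpha> \<beta> m i) 1\<rceil>"

definition total_bits :: "nat \<Rightarrow> (nat \<Rightarrow> nat) \<Rightarrow> nat" where
  "total_bits m p = (\<Sum>i=1..m. p i)"

end

theory Submission
  imports Defs "HOL-Real_Asymp.Real_Asymp"
begin

text \<open>
The four claims are two-sided bounds for \<open>rbit\<close>, \<open>quant\<close>, the error of the explicit approximation and
its number of bits. The first three are compared with the rate \<open>g p = sqrt (power_log (\<beta> - 1) \<alpha> p)\<close>, which is
the function of \<open>p\<close> in the theorem. As \<open>quant \<mu> p \<le> rbit \<mu> p\<close>, and \<open>rbit\<close> is at most the error of any
approximation with the given number of bits, it is enough to bound \<open>quant\<close> from below and the error of the
approximation from above.

Upper bound. Replacing a standard normal variable by its version with \<open>p\<close> bits costs a mean-square error of at most a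
constant times \<open>1 / 2 ^ p\<close> (\<open>normal_approx_error_le\<close>): since \<open>\<Phi> (1 - \<Phi>)\<close> is at most a multiple of the normal
density, the quantile function is Lipschitz with respect to the logit, so it suffices to
compare \<open>ln u\<close> with \<open>ln (cell_midpoint p u)\<close> for a uniform variable \<open>u\<close>, and likewise for \<open>1 - u\<close>. By
orthonormality the mean-square error of the approximation is at most a multiple of the sum of \<open>lam i\<close> over
\<open>i > m\<close> and of \<open>lam i / 2 ^ p i\<close> over \<open>i \<le> m\<close> (\<open>KL_approx_error_le\<close>). The bit numbers are chosen so
that every term of the second sum is at most a multiple of \<open>power_log \<beta> \<alpha> m\<close> (\<open>power_log_div_bits_le\<close>);
both sums are therefore at most of order \<open>(g m)\<^sup>2\<close> (\<open>sum_power_log_tail_le\<close>). The total number of bits is of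
order \<open>m\<close>, because \<open>ln (m / i)\<close> has a bounded mean over \<open>i \<le> m\<close>, and \<open>g\<close> keeps its order when
its argument is multiplied by a constant. Surplus bits can be given to the first coordinate, which yields the bound
for \<open>rbit \<mu> p\<close> at every \<open>p\<close>.

Lower bound. A \<open>p\<close>-dimensional standard normal vector lies in a fixed ball of squared radius \<open>p / 128\<close>
with probability at most \<open>1 / 4 ^ p\<close>, whatever the centre (\<open>std_normal_small_ball\<close>, an exponential
Markov inequality). Looking at the first \<open>p\<close> coordinates only, \<open>X\<close> lies in a fixed ball of squared radius
\<open>p * lam p / 128\<close> with at most that probability. Hence \<open>2 ^ p\<close> such balls carry mass at most \<open>1 / 2\<close>, so any
measure supported on \<open>2 ^ p\<close> points has squared distance at least \<open>p * lam p / 256\<close> from the law of \<open>X\<close>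
(\<open>quant_ge_of_small_balls\<close>), and \<open>p * lam p\<close> is of order \<open>(g p)\<^sup>2\<close>.
\<close>

section \<open>The standard normal distribution function\<close>

interpretation std_normal: cdf_distribution std_normal_distribution
  unfolding cdf_distribution_def by (rule real_dist_normal_dist)

lemma mono_std_normal_cdf: "mono std_normal_cdf"
  unfolding std_normal_cdf_def by (intro monoI std_normal.cdf_nondecreasing)

lemma borel_measurable_std_normal_cdf [measurable]: "std_normal_cdf \<in> borel_measurable borel"
  by (intro borel_measurable_mono mono_std_normal_cdf)

lemma has_integral_std_normal_density:
  assumes "a \<le> b"
  shows "(std_normal_density has_integral (std_normal_cdf b - std_normal_cdf a)) {a..b}"
proof (cases "a = b")
  case True
  then show ?thesis using has_integral_refl(2)[of std_normal_density b] by simp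
next
  case False
  with assms have ab: "a < b" by simp
  have int: "set_integrable lborel {a..b} std_normal_density"
    unfolding set_integrable_def
    by (rule integrable_mult_indicator[OF _ integrable_normal_density]) simp_all
  have "emeasure std_normal_distribution {a<..b}
      = (\<integral>\<^sup>+x. ennreal (indicator {a..b} x *\<^sub>R std_normal_density x) \<partial>lborel)"
    using AE_lborel_singleton[of a]
    by (subst emeasure_density)
       (auto intro!: nn_integral_cong_AE simp: indicator_def split: if_splits)
  also have "\<dots> = ennreal (LINT x:{a..b}|lborel. std_normal_density x)"
    unfolding set_lebesgue_integral_def
    using int by (intro nn_integral_eq_integral) (auto simp: set_integrable_def)
  finally have "std_normal_cdf b - std_normal_cdf a = (LINT x:{a..b}|lborel. std_normal_density x)"
    unfolding std_normal_cdf_def using ab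
    by (subst std_normal.cdf_diff_eq)
       (auto simp: measure_def set_lebesgue_integral_def intro!: Bochner_Integration.integral_nonneg)
  then show ?thesis
    using set_borel_integral_eq_integral[OF int] by (simp add: has_integral_iff)
qed

lemma std_normal_cdf_has_real_derivative:
  "(std_normal_cdf has_real_derivative std_normal_density x) (at x)"
proof -
  have "continuous_on {x - 1..x + 1} std_normal_density"
    unfolding std_normal_density_def by (intro continuous_intros) simp_all
  then have "((\<lambda>u. integral {x - 1..u} std_normal_density) has_real_derivative std_normal_density x)
      (at x within {x - 1..x + 1})"
    by (intro integral_has_real_derivative) auto
  then have "((\<lambda>u. std_normal_cdf (x - 1) + integral {x - 1..u} std_normal_density)
      has_real_derivative std_normal_density x) (at x within {x - 1..x + 1})"
    by (auto intro!: derivative_eq_intros)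
  then have "(std_normal_cdf has_real_derivative std_normal_density x) (at x within {x - 1..x + 1})"
    by (rule has_field_derivative_transform_within[where d = 1])
       (auto dest!: has_integral_std_normal_density simp: has_integral_iff)
  then show ?thesis
    by (subst (asm) at_within_interior) (auto simp: interior_atLeastAtMost_real)
qed

lemma strict_mono_std_normal_cdf: "strict_mono std_normal_cdf"

proof (rule strict_monoI)
  fix x y :: real assume "x < y"
  then show "std_normal_cdf x < std_normal_cdf y"
  proof (rule DERIV_pos_imp_increasing)
    fix z show "\<exists>d. (std_normal_cdf has_real_derivative d) (at z) \<and> 0 < d"
      using std_normal_cdf_has_real_derivative[of z] normal_density_pos[of 1 0 z] by auto
  qed
qed

lemma std_normal_cdf_bounds: "0 < std_normal_cdf x" "std_normal_cdf x < 1"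
proof -
  have "std_normal_cdf (x - 1) < std_normal_cdf x" "std_normal_cdf x < std_normal_cdf (x + 1)"
    by (auto intro!: strict_monoD[OF strict_mono_std_normal_cdf])
  moreover have "0 \<le> std_normal_cdf (x - 1)" "std_normal_cdf (x + 1) \<le> 1"
    unfolding std_normal_cdf_def by (auto simp: std_normal.cdf_nonneg std_normal.cdf_bounded_prob)
  ultimately show "0 < std_normal_cdf x" "std_normal_cdf x < 1" by linarith+
qed

lemma std_normal_cdf_inv:
  assumes "0 < u" "u < 1"
  shows "std_normal_cdf (inv std_normal_cdf u) = u"
proof (rule f_inv_into_f)
  have "eventually (\<lambda>x. std_normal_cdf x < u) at_bot"
    using std_normal.cdf_lim_at_bot assms(1) unfolding std_normal_cdf_def by (rule order_tendstoD)
  then obtain a where a: "std_normal_cdf a < u"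
    by (auto simp: eventually_at_bot_linorder)
  have "eventually (\<lambda>x. u < std_normal_cdf x) at_top"
    using std_normal.cdf_lim_at_top_prob assms(2) unfolding std_normal_cdf_def by (rule order_tendstoD)
  then obtain b where b: "u < std_normal_cdf b"
    by (auto simp: eventually_at_top_linorder)
  have "a \<le> b"
    using a b strict_mono_less[OF strict_mono_std_normal_cdf, of a b] by linarith
  then obtain x where "std_normal_cdf x = u"
    using IVT[of std_normal_cdf a u b] a b
      DERIV_isCont[OF std_normal_cdf_has_real_derivative] by auto
  then show "u \<in> range std_normal_cdf" by blast
qed


text \<open>
The probability integral transform: \<open>std_normal_cdf Y\<close> is uniformly distributed. The left inverse
\<open>std_normal.I\<close> of the distribution function turns a uniform variable into a normal one, and here it is a
right inverse as well because the distribution function is strictly increasing.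
\<close>

lemma nn_integral_std_normal_cdf:
  assumes [measurable]: "f \<in> borel_measurable borel"
  shows "(\<integral>\<^sup>+y. f (std_normal_cdf y) \<partial>std_normal_distribution)
      = (\<integral>\<^sup>+u. f u * indicator {0<..<1} u \<partial>lborel)"
proof -
  let ?U = "restrict_space lborel {0<..<1 :: real}"
  have [measurable]: "std_normal.I \<in> borel_measurable ?U"
    using std_normal.measurable_CI
    by (subst measurable_cong_sets[OF sets_restrict_space_cong[OF sets_lborel] refl])
  have I: "std_normal_cdf (std_normal.I u) = u" if "u \<in> {0<..<1}" for u
  proof -
    have *: "u \<le> std_normal_cdf x \<longleftrightarrow> std_normal.I u \<le> x" for x
      using std_normal.pseudoinverse[of u x] that by (simp add: std_normal_cdf_def)
    have "std_normal.I u \<le> inv std_normal_cdf u"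
      using *[of "inv std_normal_cdf u"] that by (simp add: std_normal_cdf_inv)
    then have "std_normal_cdf (std_normal.I u) \<le> u"
      using monoD[OF mono_std_normal_cdf] std_normal_cdf_inv[of u] that by fastforce
    with *[of "std_normal.I u"] show ?thesis by simp
  qed
  have "(\<integral>\<^sup>+y. f (std_normal_cdf y) \<partial>std_normal_distribution)
      = (\<integral>\<^sup>+y. f (std_normal_cdf y) \<partial>distr ?U borel std_normal.I)"
    by (simp add: std_normal.distr_I_eq_M)
  also have "\<dots> = (\<integral>\<^sup>+u. f (std_normal_cdf (std_normal.I u)) \<partial>?U)"
    by (intro nn_integral_distr) auto
  also have "\<dots> = (\<integral>\<^sup>+u. f u \<partial>?U)"
    by (intro nn_integral_cong) (simp add: I space_restrict_space)
  also have "\<dots> = (\<integral>\<^sup>+u. f u * indicator {0<..<1} u \<partial>lborel)"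
    by (subst nn_integral_restrict_space) auto
  finally show ?thesis .
qed

text \<open>
Both tails are treated at once, with the sign \<open>c\<close>. Beyond \<open>y' = c y\<close>, the normal density
is at most \<open>exp (-y\<^sup>2/2)\<close> times the density shifted to \<open>y'\<close>, since \<open>z\<^sup>2 - y\<^sup>2 - (z - y')\<^sup>2 = 2 y (c z - y)\<close>
is nonnegative there.
\<close>

lemma std_normal_tail_le:
  assumes "0 \<le> y"
  shows "1 - std_normal_cdf y \<le> exp (- y\<^sup>2 / 2)" "std_normal_cdf (- y) \<le> exp (- y\<^sup>2 / 2)"
proof -
  have *: "measure std_normal_distribution A \<le> exp (- y\<^sup>2 / 2)"
    if A [measurable]: "A \<in> sets borel" and z: "\<And>z. z \<in> A \<Longrightarrow> c * z \<ge> c * y'"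
      and c: "c * y' = y" "\<bar>c\<bar> = 1" for A :: "real set" and c y' :: real
  proof -
    have "emeasure std_normal_distribution A
        = (\<integral>\<^sup>+z. ennreal (std_normal_density z) * indicator A z \<partial>lborel)"
      by (subst emeasure_density) auto
    also have "\<dots> \<le> (\<integral>\<^sup>+z. ennreal (exp (- y\<^sup>2 / 2)) * ennreal (normal_density y' 1 z) \<partial>lborel)"
    proof (intro nn_integral_mono)
      fix z :: real
      have "std_normal_density z \<le> exp (- y\<^sup>2 / 2) * normal_density y' 1 z" if "z \<in> A"
      proof -
        have cc: "c * c = 1" using c(2) abs_mult_self_eq[of c] by simp
        then have y': "y' = c * y" using c(1) by (simp add: mult.assoc[symmetric] flip: c(1))
        have "y * (c * z - y) \<ge> 0"
          using z[OF that] c(1) assms by simp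
        then have "y\<^sup>2 + (z - y')\<^sup>2 \<le> z\<^sup>2"
          unfolding y'
        proof -
          have "(z - c * y)\<^sup>2 = z\<^sup>2 - 2 * (y * (c * z)) + (c * c) * y\<^sup>2"
            by (simp add: power2_eq_square algebra_simps)
          moreover have "y * (c * z) \<ge> y\<^sup>2"
            using \<open>y * (c * z - y) \<ge> 0\<close> by (simp add: power2_eq_square right_diff_distrib)
          ultimately show "y\<^sup>2 + (z - c * y)\<^sup>2 \<le> z\<^sup>2"
            using cc by simp
        qed
        then have "exp (- z\<^sup>2 / 2) \<le> exp (- y\<^sup>2 / 2) * exp (- (z - y')\<^sup>2 / 2)"
          by (simp add: exp_add[symmetric] field_simps)
        then show ?thesis
          by (simp add: normal_density_def field_simps)
      qed
      then show "ennreal (std_normal_density z) * indicator A z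
          \<le> ennreal (exp (- y\<^sup>2 / 2)) * ennreal (normal_density y' 1 z)"
        by (auto simp: indicator_def ennreal_mult''[symmetric] intro!: ennreal_leI)
    qed
    also have "\<dots> = ennreal (exp (- y\<^sup>2 / 2)) * 1"
      by (subst nn_integral_cmult) (auto simp: nn_integral_eq_integral)
    finally show ?thesis
      by (simp add: measure_def enn2real_leI)
  qed
  have "1 - std_normal_cdf y = measure std_normal_distribution {y<..}"
    using std_normal.prob_compl[of "{..y}"]
    by (simp add: std_normal_cdf_def cdf_def Compl_eq_Diff_UNIV[symmetric] Compl_atMost)
  then show "1 - std_normal_cdf y \<le> exp (- y\<^sup>2 / 2)"
    using *[of "{y<..}" 1 y] by simp
  show "std_normal_cdf (- y) \<le> exp (- y\<^sup>2 / 2)"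
    using *[of "{..-y}" "-1" "-y"] by (simp add: std_normal_cdf_def cdf_def)
qed


lemma std_normal_cdf_mult_tail_le:
  "std_normal_cdf y * (1 - std_normal_cdf y) \<le> 3 * std_normal_density y"
proof -
  have "sqrt (2 * pi) \<le> 3"
    using pi_less_4 by (intro real_le_lsqrt) auto
  then have "exp (- y\<^sup>2 / 2) \<le> 3 * std_normal_density y"
    by (simp add: std_normal_density_def field_simps)
  moreover have "std_normal_cdf y * (1 - std_normal_cdf y) \<le> exp (- y\<^sup>2 / 2)"
  proof (cases "0 \<le> y")
    case True
    then have "std_normal_cdf y * (1 - std_normal_cdf y) \<le> 1 * exp (- y\<^sup>2 / 2)"
      using std_normal_cdf_bounds[of y] by (intro mult_mono std_normal_tail_le) auto
    then show ?thesis by simp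
  next
    case False
    then have "std_normal_cdf (- (- y)) * (1 - std_normal_cdf y) \<le> exp (- (- y)\<^sup>2 / 2) * 1"
      using std_normal_cdf_bounds[of y] by (intro mult_mono std_normal_tail_le) auto
    then show ?thesis by simp
  qed
  ultimately show ?thesis by linarith
qed

text \<open>
The derivative of \<open>F\<close> is the density divided by \<open>\<Phi>(1 - \<Phi>)\<close>, hence at least \<open>1/3\<close>. Measuring distances on the
logit scale makes the two tails and the centre of the distribution amenable to one and the same estimate.
\<close>

lemma abs_diff_le_logit_std_normal_cdf:
  defines "F \<equiv> \<lambda>y. ln (std_normal_cdf y) - ln (1 - std_normal_cdf y)"
  shows "\<bar>y - z\<bar> \<le> 3 * \<bar>F y - F z\<bar>"
proof -
  have deriv: "((\<lambda>y. 3 * F y - y) has_real_derivative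
      3 * (std_normal_density y / std_normal_cdf y + std_normal_density y / (1 - std_normal_cdf y)) - 1) (at y)" for y
    unfolding F_def using std_normal_cdf_bounds[of y]
    by (auto intro!: derivative_eq_intros std_normal_cdf_has_real_derivative simp: field_simps)
  have "0 \<le> 3 * (std_normal_density y / std_normal_cdf y + std_normal_density y / (1 - std_normal_cdf y)) - 1" for y
  proof -
    have "std_normal_density y / std_normal_cdf y + std_normal_density y / (1 - std_normal_cdf y)
        = std_normal_density y / (std_normal_cdf y * (1 - std_normal_cdf y))"
      using std_normal_cdf_bounds[of y] by (simp add: field_simps)
    moreover have "1 \<le> 3 * std_normal_density y / (std_normal_cdf y * (1 - std_normal_cdf y))"
      using std_normal_cdf_bounds[of y] std_normal_cdf_mult_tail_le[of y] by (simp add: le_divide_eq)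
    ultimately show ?thesis by simp
  qed
  then have mono: "3 * F a - a \<le> 3 * F b - b" if "a \<le> b" for a b
    using that deriv by (intro DERIV_nonneg_imp_nondecreasing[of a b "\<lambda>y. 3 * F y - y"]) blast+
  show ?thesis
    using mono[of y z] mono[of z y] by (cases "y \<le> z") simp_all
qed

section \<open>Quantizing a standard normal variable\<close>

text \<open>
With cells of length one, \<open>25 * log_ratio_majorant x\<close> bounds the squared distance of \<open>ln x\<close> from
the logarithm of the midpoint of the cell of \<open>x\<close>. What matters is that it is integrable at zero and at infinity;
the exponent \<open>-1/2\<close> replaces a squared logarithm by a power whose integral is elementary.
\<close>

definition log_ratio_majorant :: "real \<Rightarrow> real" where
  "log_ratio_majorant x = (if x < 1 then x powr (- 1 / 2) else x powr (- 2))"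

lemma borel_measurable_log_ratio_majorant [measurable]:
  "log_ratio_majorant \<in> borel_measurable borel"
  unfolding log_ratio_majorant_def by measurable

lemma log_ratio_majorant_nonneg: "0 \<le> log_ratio_majorant x"
  by (simp add: log_ratio_majorant_def)

text \<open>
Away from the cell at zero the two numbers differ by a factor of at most two, and \<open>ln\<close> has slope at most \<open>2/x\<close>
between them. In the cell at zero \<open>x'\<close> stays fixed while \<open>ln x\<close> is unbounded, so \<open>|ln x| \<le> 4 x\<^sup>-\<^sup>1\<^sup>/\<^sup>4\<close> is used.
\<close>

lemma log_ratio_sq_le:
  assumes x: "0 < x" and x': "0 < x'" and close: "\<bar>x - x'\<bar> \<le> 1 / 2"
    and edge: "x < 1 \<Longrightarrow> x' = 1 / 2"
  shows "(ln x - ln x')\<^sup>2 \<le> 25 * log_ratio_majorant x"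
proof (cases "x < 1")
  case True
  define t where "t = x powr (- 1 / 4)"
  have "1 powr (- 1 / 4) \<le> t"
    unfolding t_def using True x by (intro powr_mono2') auto
  then have t1: "1 \<le> t" by simp
  have "ln t = - ln x / 4"
    using x by (simp add: t_def ln_powr)
  with ln_le_minus_one[of t] t1 have "- ln x \<le> 4 * t" by simp
  moreover have "ln x \<le> 0" using True x by simp
  moreover have "0 \<le> ln (2::real)" "ln (2::real) \<le> 1"
    using ln_le_minus_one[of 2] by auto
  moreover have "ln x' = - ln 2" by (subst edge[OF True]) (simp add: ln_div)
  ultimately have "\<bar>ln x - ln x'\<bar> \<le> 5 * t" using t1 by linarith
  then have "(ln x - ln x')\<^sup>2 \<le> (5 * t)\<^sup>2"
    by (metis abs_ge_zero power2_abs power_mono)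
  also have "\<dots> = 25 * (t * t)" by (simp add: power2_eq_square)
  also have "t * t = log_ratio_majorant x"
    using True by (simp add: log_ratio_majorant_def t_def powr_add[symmetric])
  finally show ?thesis .
next
  case False
  then have x1: "1 \<le> x" by simp
  then have x'2: "x / 2 \<le> x'" using close by linarith
  have "ln x - ln x' = ln (x / x')" using x x' by (simp add: ln_div)
  also have "\<dots> \<le> x / x' - 1" using x x' by (intro ln_le_minus_one) simp
  also have "\<dots> = (x - x') / x'" using x' by (simp add: field_simps)
  also have "\<dots> \<le> (1 / 2) / (x / 2)" using x x'2 abs_le_D1[OF close] by (intro frac_le) auto
  finally have 1: "ln x - ln x' \<le> 1 / x" by simp
  have "ln x' - ln x = ln (x' / x)" using x x' by (simp add: ln_div)
  also have "\<dots> \<le> x' / x - 1" using x x' by (intro ln_le_minus_one) simp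
  also have "\<dots> = (x' - x) / x" using x by (simp add: field_simps)
  also have "\<dots> \<le> 1 / x" using x abs_le_D2[OF close] by (intro divide_right_mono) auto
  finally have "\<bar>ln x - ln x'\<bar> \<le> 1 / x" using 1 by linarith
  then have "(ln x - ln x')\<^sup>2 \<le> (1 / x)\<^sup>2"
    by (metis abs_ge_zero power2_abs power_mono)
  also have "\<dots> = log_ratio_majorant x"
    using False x by (simp add: log_ratio_majorant_def powr_minus powr_numeral power2_eq_square field_simps)
  also have "\<dots> \<le> 25 * log_ratio_majorant x"
    using log_ratio_majorant_nonneg[of x] by simp
  finally show ?thesis .
qed

lemma nn_integral_log_ratio_majorant:
  "(\<integral>\<^sup>+x. ennreal (log_ratio_majorant x) * indicator {0<..} x \<partial>lborel) \<le> 3"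
proof -
  have "((\<lambda>x. x powr (- 1 / 2)) has_integral 2) {0..1 :: real}"
    using has_integral_powr_from_0[of "- 1 / 2" 1] by simp
  then have a: "(\<integral>\<^sup>+x. ennreal (indicator {0..1 :: real} x * x powr (- 1 / 2)) \<partial>lborel) = ennreal 2"
    by (intro nn_integral_has_integral_lebesgue) auto
  have "((\<lambda>x. x powr (- 2)) has_integral 1) {1 :: real..}"
    using has_integral_powr_to_inf[of "- 2" 1] by simp
  then have b: "(\<integral>\<^sup>+x. ennreal (indicator {1 :: real..} x * x powr (- 2)) \<partial>lborel) = ennreal 1"
    by (intro nn_integral_has_integral_lebesgue) auto
  have "(\<integral>\<^sup>+x. ennreal (log_ratio_majorant x) * indicator {0<..} x \<partial>lborel)
      \<le> (\<integral>\<^sup>+x. ennreal (indicator {0..1 :: real} x * x powr (- 1 / 2))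
           + ennreal (indicator {1 :: real..} x * x powr (- 2)) \<partial>lborel)"
    by (intro nn_integral_mono) (auto simp: log_ratio_majorant_def indicator_def)
  also have "\<dots> = ennreal 2 + ennreal 1"
    by (subst nn_integral_add, measurable) (simp only: a b)
  also have "\<dots> = 3"
    by simp
  finally show ?thesis .
qed

text \<open>
The integral over a uniform variable is reduced to \<open>3 / 2\<^sup>p\<close> by the substitution \<open>x = 2\<^sup>p u\<close>; the
reflected substitution \<open>x = 2\<^sup>p (1 - u)\<close> is covered by negative \<open>c\<close>.
\<close>

lemma nn_integral_log_ratio_majorant_scaled:
  assumes "\<bar>c\<bar> = 2 ^ p"
  shows "(\<integral>\<^sup>+u. ennreal (log_ratio_majorant (t + c * u)) * indicator {0<..} (t + c * u) \<partial>lborel)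
    \<le> ennreal (3 / 2 ^ p)"
proof -
  let ?f = "\<lambda>x. ennreal (log_ratio_majorant x) * indicator {0<..} x"
  have "ennreal (2 ^ p) * (\<integral>\<^sup>+u. ?f (t + c * u) \<partial>lborel) = (\<integral>\<^sup>+x. ?f x \<partial>lborel)"
    using assms by (subst (2) nn_integral_real_affine[of _ c t]) auto
  then have "ennreal (2 ^ p) * (\<integral>\<^sup>+u. ?f (t + c * u) \<partial>lborel) \<le> 3"
    using nn_integral_log_ratio_majorant by simp
  then have "ennreal (1 / 2 ^ p) * (ennreal (2 ^ p) * (\<integral>\<^sup>+u. ?f (t + c * u) \<partial>lborel))
      \<le> ennreal (1 / 2 ^ p) * ennreal 3"
    by (intro mult_left_mono) auto
  then show ?thesis
    by (simp add: mult.assoc[symmetric] ennreal_mult[symmetric] del: ennreal_numeral)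
qed

text \<open>
The last two statements single out the first and the last cell, where \<open>ln u\<close> and \<open>ln (1 - u)\<close>, respectively,
are unbounded.
\<close>

lemma cell_midpoint_bounds:
  assumes u: "0 < u" "u < 1"
  shows "0 < cell_midpoint p u" "cell_midpoint p u < 1"
    and "\<bar>2 ^ p * u - 2 ^ p * cell_midpoint p u\<bar> \<le> 1 / 2"
    and "2 ^ p * u < 1 \<Longrightarrow> 2 ^ p * cell_midpoint p u = 1 / 2"
    and "2 ^ p * (1 - u) < 1 \<Longrightarrow> 2 ^ p * (1 - cell_midpoint p u) = 1 / 2"
proof -
  define k where "k = \<lfloor>2 ^ p * u\<rfloor>"
  have eq: "2 ^ p * cell_midpoint p u = k + 1 / 2"
    by (simp add: cell_midpoint_def k_def field_simps)
  have k: "k \<le> 2 ^ p * u" "2 ^ p * u < k + 1"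
    unfolding k_def by linarith+
  have "0 \<le> k" using u by (simp add: k_def)
  have "2 ^ p * u < 2 ^ p" using u by simp
  then have "real_of_int k < 2 ^ p" using k by linarith
  then have "k < 2 ^ p" by (simp flip: of_int_less_iff)
  then have "k + 1 \<le> 2 ^ p" by simp
  then have kp: "real_of_int k + 1 \<le> 2 ^ p" using of_int_le_iff[of "k + 1" "2 ^ p", where 'a = real] by simp
  show "0 < cell_midpoint p u"
    using \<open>0 \<le> k\<close> by (simp add: cell_midpoint_def k_def add_nonneg_pos)
  have "2 ^ p * cell_midpoint p u < 2 ^ p * 1" unfolding eq using kp by simp
  then show "cell_midpoint p u < 1" by (subst (asm) mult_less_cancel_left_pos) auto
  show "\<bar>2 ^ p * u - 2 ^ p * cell_midpoint p u\<bar> \<le> 1 / 2"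
    unfolding eq using k by linarith
  show "2 ^ p * cell_midpoint p u = 1 / 2" if "2 ^ p * u < 1"
  proof -
    have "real_of_int k < 1" using k(1) that by linarith
    then have "k = 0" using \<open>0 \<le> k\<close> by simp
    then show ?thesis by (simp add: eq)
  qed
  show "2 ^ p * (1 - cell_midpoint p u) = 1 / 2" if "2 ^ p * (1 - u) < 1"
  proof -
    have "2 ^ p < real_of_int k + 2" using k(2) that by (simp add: right_diff_distrib)
    then have "real_of_int (2 ^ p) < real_of_int (k + 2)" by simp
    then have "2 ^ p = k + 1" using \<open>k + 1 \<le> 2 ^ p\<close> unfolding of_int_less_iff by linarith
    then have "real_of_int (2 ^ p) = real_of_int (k + 1)" by (simp only:)
    then have "(2::real) ^ p = real_of_int k + 1" by simp
    then show ?thesis unfolding right_diff_distrib eq by simp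
  qed
qed

lemma mono_normal_approx: "mono (normal_approx p)"
proof (rule monoI)
  fix x y :: real assume "x \<le> y"
  then have "std_normal_cdf x \<le> std_normal_cdf y" by (rule monoD[OF mono_std_normal_cdf])
  then have "cell_midpoint p (std_normal_cdf x) \<le> cell_midpoint p (std_normal_cdf y)"
    unfolding cell_midpoint_def
    by (intro add_right_mono divide_right_mono of_int_le_iff[THEN iffD2] floor_mono mult_left_mono) auto
  then have "std_normal_cdf (normal_approx p x) \<le> std_normal_cdf (normal_approx p y)"
    by (simp add: normal_approx_def std_normal_cdf_inv std_normal_cdf_bounds cell_midpoint_bounds)
  then show "normal_approx p x \<le> normal_approx p y"
    by (simp add: strict_mono_less_eq[OF strict_mono_std_normal_cdf])
qed

lemma borel_measurable_normal_approx [measurable]: "normal_approx p \<in> borel_measurable borel"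
  by (intro borel_measurable_mono mono_normal_approx)

text \<open>
On the logit scale the quantization error splits into the errors of \<open>ln u\<close> and of \<open>ln (1 - u)\<close>. Each is
bounded by \<open>log_ratio_majorant\<close> after scaling by \<open>2\<^sup>p\<close>, and the scaling produces the factor \<open>2\<^sup>-\<^sup>p\<close>.
\<close>

lemma normal_approx_error_le:
  "(\<integral>\<^sup>+y. ennreal ((y - normal_approx p y)\<^sup>2) \<partial>std_normal_distribution) \<le> ennreal (2700 / 2 ^ p)"
proof -
  let ?h = "\<lambda>x. ennreal (log_ratio_majorant x) * indicator {0<..} x"
  \<comment> \<open>\<open>450 = 3\<^sup>2 * 2 * 25\<close>: the slope of the quantile function in the logit, splitting the square, the majorant\<close>
  let ?f = "\<lambda>u. ennreal 450 * (?h (0 + 2 ^ p * u) + ?h (2 ^ p + (- (2 ^ p)) * u))"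
  have "ennreal ((y - normal_approx p y)\<^sup>2) \<le> ?f (std_normal_cdf y)" for y
  proof -
    define u v where "u = std_normal_cdf y" and "v = cell_midpoint p u"
    have u: "0 < u" "u < 1" by (simp_all add: u_def std_normal_cdf_bounds)
    note v = cell_midpoint_bounds[OF u, of p, folded v_def]
    have cdf_approx: "std_normal_cdf (normal_approx p y) = v"
      using v(1,2) by (simp add: normal_approx_def std_normal_cdf_inv u_def v_def)
    define a b where "a = ln (2 ^ p * u) - ln (2 ^ p * v)"
      and "b = ln (2 ^ p * (1 - u)) - ln (2 ^ p * (1 - v))"
    have a: "a\<^sup>2 \<le> 25 * log_ratio_majorant (2 ^ p * u)"
      unfolding a_def using u v by (intro log_ratio_sq_le) auto
    have b: "b\<^sup>2 \<le> 25 * log_ratio_majorant (2 ^ p * (1 - u))"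
      unfolding b_def using u v(1,2,5)
      by (intro log_ratio_sq_le) (use v(3) in \<open>simp_all add: right_diff_distrib abs_minus_commute\<close>)
    have "a - b = ln u - ln (1 - u) - (ln v - ln (1 - v))"
      using u v(1,2) by (simp add: a_def b_def ln_mult)
    then have "\<bar>y - normal_approx p y\<bar> \<le> 3 * \<bar>a - b\<bar>"
      using abs_diff_le_logit_std_normal_cdf[of y "normal_approx p y"] u v(1,2)
      by (simp add: cdf_approx flip: u_def)
    then have "(y - normal_approx p y)\<^sup>2 \<le> (3 * \<bar>a - b\<bar>)\<^sup>2"
      by (metis abs_ge_zero power2_abs power_mono)
    also have "\<dots> = 9 * (a - b)\<^sup>2"
      by (simp add: power_mult_distrib)
    also have "\<dots> \<le> 18 * (a\<^sup>2 + b\<^sup>2)"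
      using zero_le_power2[of "a + b"] by (simp add: power2_eq_square algebra_simps)
    also have "\<dots> \<le> 450 * (log_ratio_majorant (2 ^ p * u) + log_ratio_majorant (2 ^ p * (1 - u)))"
      using a b by simp
    finally have "ennreal ((y - normal_approx p y)\<^sup>2)
        \<le> ennreal (450 * (log_ratio_majorant (2 ^ p * u) + log_ratio_majorant (2 ^ p * (1 - u))))"
      by (rule ennreal_leI)
    also have "\<dots> = ?f u"
      using u by (simp add: ennreal_mult log_ratio_majorant_nonneg ennreal_plus right_diff_distrib distrib_left del: ennreal_numeral)
    finally show ?thesis by (simp only: u_def)
  qed
  then have "(\<integral>\<^sup>+y. ennreal ((y - normal_approx p y)\<^sup>2) \<partial>std_normal_distribution)
      \<le> (\<integral>\<^sup>+y. ?f (std_normal_cdf y) \<partial>std_normal_distribution)"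
    by (intro nn_integral_mono)
  also have "\<dots> = (\<integral>\<^sup>+u. ?f u * indicator {0<..<1} u \<partial>lborel)"
    by (intro nn_integral_std_normal_cdf) measurable
  also have "\<dots> \<le> (\<integral>\<^sup>+u. ?f u \<partial>lborel)"
    by (intro nn_integral_mono) (simp add: indicator_def)
  also have "\<dots> = ennreal 450 * ((\<integral>\<^sup>+u. ?h (0 + 2 ^ p * u) \<partial>lborel)
      + (\<integral>\<^sup>+u. ?h (2 ^ p + (- (2 ^ p)) * u) \<partial>lborel))"
    by (subst nn_integral_cmult, measurable, subst nn_integral_add, measurable)
  also have "\<dots> \<le> ennreal 450 * (ennreal (3 / 2 ^ p) + ennreal (3 / 2 ^ p))"
    by (intro mult_left_mono add_mono nn_integral_log_ratio_majorant_scaled) auto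
  also have "\<dots> = ennreal (2700 / 2 ^ p)"
    by (simp add: ennreal_plus[symmetric] ennreal_mult[symmetric] del: ennreal_plus ennreal_numeral)
  finally show ?thesis .
qed

lemma cell_probability:
  assumes "k < 2 ^ p"
  shows "emeasure std_normal_distribution {y. \<lfloor>2 ^ p * std_normal_cdf y\<rfloor> = int k} = ennreal (1 / 2 ^ p)"
proof -
  let ?A = "{u :: real. \<lfloor>2 ^ p * u\<rfloor> = int k}"
  have [measurable]: "?A \<in> sets borel" by measurable
  have "real k + 1 \<le> 2 ^ p"
    using assms of_nat_le_iff[of "Suc k" "2 ^ p", where 'a = real] by simp
  then have A: "?A = {k / 2 ^ p..<(k + 1) / 2 ^ p}" "(k + 1) / 2 ^ p \<le> (1 :: real)"
    by (auto simp: floor_eq_iff field_simps)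
  have "emeasure std_normal_distribution {y. \<lfloor>2 ^ p * std_normal_cdf y\<rfloor> = int k}
      = (\<integral>\<^sup>+y. indicator ?A (std_normal_cdf y) \<partial>std_normal_distribution)"
  proof -
    have B: "{y. \<lfloor>2 ^ p * std_normal_cdf y\<rfloor> = int k} \<in> sets std_normal_distribution" by measurable
    have *: "indicator ?A (std_normal_cdf y) = indicator {y. \<lfloor>2 ^ p * std_normal_cdf y\<rfloor> = int k} y" for y
      by (simp add: indicator_def)
    show ?thesis unfolding * using B by (rule nn_integral_indicator[symmetric])
  qed
  also have "\<dots> = (\<integral>\<^sup>+u. indicator ?A u * indicator {0<..<1} u \<partial>lborel)"
    by (rule nn_integral_std_normal_cdf) measurable
  also have "\<dots> = (\<integral>\<^sup>+u. indicator {k / 2 ^ p..<(k + 1) / 2 ^ p} u \<partial>lborel)"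
    unfolding A(1)
  proof (rule nn_integral_cong_AE, use AE_lborel_singleton[of 0] in eventually_elim)
    case (elim u)
    show ?case
    proof (cases "u \<in> {k / 2 ^ p..<(k + 1) / 2 ^ p}")
      case True
      then have "k / 2 ^ p \<le> u" "u < (k + 1) / 2 ^ p" by auto
      moreover have "0 \<le> k / (2 :: real) ^ p" by simp
      ultimately have "0 < u" "u < 1" using elim A(2) by linarith+
      then have "u \<in> {0<..<1}" by simp
      then show ?thesis by simp
    qed simp
  qed
  also have "\<dots> = ennreal (1 / 2 ^ p)"
    by (simp add: divide_right_mono diff_divide_distrib[symmetric])
  finally show ?thesis .
qed

section \<open>Regularly varying sequences\<close>

text \<open>
The regularly varying comparison sequence: for \<open>b = \<beta>\<close> it has the order of the eigenvalues, for
\<open>b = \<beta> - 1\<close> that of their tail sums, which is the squared rate. The shift in \<open>ln (n + 1)\<close> keeps it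
positive at \<open>n = 1\<close>.
\<close>

definition power_log :: "real \<Rightarrow> real \<Rightarrow> nat \<Rightarrow> real" where
  "power_log b a n = real n powr (- b) * ln (real n + 1) powr (- a)"

lemma power_log_pos: "1 \<le> n \<Longrightarrow> 0 < power_log b a n"
  by (simp add: power_log_def)

text \<open>
By concavity of the logarithm \<open>ln (n + 1) / n\<close> is decreasing. This elementary bound controls both the
logarithmic part of the bit numbers and the variation of \<open>power_log\<close> between comparable arguments.
\<close>

lemma ln_succ_ratio_le:
  assumes "1 \<le> i" "i \<le> m"
  shows "ln (real m + 1) / ln (real i + 1) \<le> real m / real i"
proof -
  have "ln (real m + 1) / real m \<le> ln (real i + 1) / real i"
    using assms(2)
  proof (induction rule: dec_induct)
    case (step n)
    have n: "1 \<le> real n" using step assms by simp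
    have "- ln (real n + 1) = ln (1 / (real n + 1))" using n by (simp add: ln_div)
    also have "\<dots> \<le> 1 / (real n + 1) - 1" by (intro ln_le_minus_one) simp
    finally have *: "real n / (real n + 1) \<le> ln (real n + 1)" using n by (simp add: field_simps)
    have "ln (real n + 2) - ln (real n + 1) = ln ((real n + 2) / (real n + 1))" using n by (simp add: ln_div)
    also have "\<dots> \<le> (real n + 2) / (real n + 1) - 1" using n by (intro ln_le_minus_one) simp
    also have "\<dots> = 1 / (real n + 1)" using n by (simp add: field_simps)
    finally have "real n * (ln (real n + 2) - ln (real n + 1)) \<le> real n * (1 / (real n + 1))"
      using n by (intro mult_left_mono) auto
    then have "real n * ln (real n + 2) \<le> (real n + 1) * ln (real n + 1)"
      using * by (simp add: algebra_simps)
    then have "ln (real n + 2) / (real n + 1) \<le> ln (real n + 1) / real n"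
      using n by (simp add: field_simps)
    with step.IH show ?case by (simp add: add.commute)
  qed simp
  then show ?thesis using assms by (simp add: field_simps)
qed

text \<open>
A Potter bound: a power of the logarithm varies more slowly than any power of its argument. For \<open>a \<ge> 0\<close> the
left-hand side is decreasing in \<open>i\<close>; for \<open>a < 0\<close> one uses \<open>ln (i + 1) \<le> ln (m + 1) + ln (i / m)\<close> and
\<open>ln x \<le> x\<^sup>\<delta> / \<delta>\<close>.
\<close>

lemma ln_succ_powr_le:
  fixes a \<epsilon> :: real
  assumes "0 < \<epsilon>"
  obtains C where "0 < C" and "\<And>m i. 1 \<le> m \<Longrightarrow> m \<le> i \<Longrightarrow>
    ln (real i + 1) powr (- a) \<le> C * (real i / real m) powr \<epsilon> * ln (real m + 1) powr (- a)"
proof (cases "0 \<le> a")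
  case True
  have "ln (real i + 1) powr (- a) \<le> 1 * (real i / real m) powr \<epsilon> * ln (real m + 1) powr (- a)"
    if "1 \<le> m" "m \<le> i" for m i
  proof -
    have "ln (real i + 1) powr (- a) \<le> ln (real m + 1) powr (- a)"
      using that True by (intro powr_mono2') auto
    moreover have "1 \<le> (real i / real m) powr \<epsilon>"
      using that assms by (intro ge_one_powr_ge_zero) auto
    ultimately show ?thesis
      using mult_mono[of 1 "(real i / real m) powr \<epsilon>" "ln (real i + 1) powr (- a)" "ln (real m + 1) powr (- a)"]
      by simp
  qed
  then show thesis using that[of 1] by simp
next
  case False
  \<comment> \<open>chosen such that \<open>(x powr \<delta>) powr (- a) = x powr \<epsilon>\<close>\<close>
  define \<delta> where "\<delta> = \<epsilon> / (- a)"
  define D where "D = 1 + 1 / (\<delta> * ln 2)"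
  have \<delta>: "0 < \<delta>" using False assms by (simp add: \<delta>_def divide_pos_neg)
  then have D: "1 < D" by (simp add: D_def)
  have "ln (real i + 1) powr (- a) \<le> D powr (- a) * (real i / real m) powr \<epsilon> * ln (real m + 1) powr (- a)"
    if "1 \<le> m" "m \<le> i" for m i
  proof -
    define x where "x = real i / real m"
    have x: "1 \<le> x" using that by (simp add: x_def)
    then have x\<delta>: "1 \<le> x powr \<delta>" using \<delta> by (intro ge_one_powr_ge_zero) auto
    have t: "1 \<le> ln (real m + 1) / ln 2" using that by (simp add: le_divide_eq)
    have "real i + 1 \<le> x * (real m + 1)" using that x by (simp add: x_def field_simps)
    then have "ln (real i + 1) \<le> ln (x * (real m + 1))" using that x by (subst ln_le_cancel_iff) auto
    also have "\<dots> = ln (real m + 1) + ln x" using that x by (simp add: ln_mult)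
    also have "ln x \<le> x powr \<delta> / \<delta>" using x \<delta> by (intro ln_powr_bound) auto
    also have "x powr \<delta> / \<delta> \<le> x powr \<delta> / \<delta> * (ln (real m + 1) / ln 2)"
      using t x \<delta> mult_left_mono[of 1 "ln (real m + 1) / ln 2" "x powr \<delta> / \<delta>"] by simp
    also have "ln (real m + 1) + x powr \<delta> / \<delta> * (ln (real m + 1) / ln 2)
        \<le> x powr \<delta> * ln (real m + 1) + x powr \<delta> / \<delta> * (ln (real m + 1) / ln 2)"
      using x\<delta> that by (simp add: mult_le_cancel_right1)
    also have "\<dots> = D * x powr \<delta> * ln (real m + 1)" by (simp add: D_def field_simps)
    finally have "ln (real i + 1) \<le> D * x powr \<delta> * ln (real m + 1)" by simp
    then have "ln (real i + 1) powr (- a) \<le> (D * x powr \<delta> * ln (real m + 1)) powr (- a)"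
      using False that by (intro powr_mono2) auto
    also have "\<dots> = D powr (- a) * x powr \<epsilon> * ln (real m + 1) powr (- a)"
      using D x that False by (simp add: powr_mult powr_powr \<delta>_def)
    finally show ?thesis by (simp add: x_def)
  qed
  then show thesis using that[of "D powr (- a)"] D by simp
qed

lemma sum_powr_tail_le:
  assumes s: "1 < s" and m: "1 \<le> m"
  shows "(\<Sum>i=m+1..n. real i powr (- s)) \<le> real m powr (1 - s) / (s - 1)"
proof -
  have *: "(\<Sum>i=m+1..n. real i powr (- s)) \<le> (real m powr (1 - s) - real n powr (1 - s)) / (s - 1)"
    if "m \<le> n" for n
    using that
  proof (induction rule: dec_induct)
    case (step n)
    have n: "1 \<le> n" using step m by simp
    have "\<exists>z>real n. z < real (Suc n) \<and> real (Suc n) powr (1 - s) - real n powr (1 - s)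
        = (real (Suc n) - real n) * ((1 - s) * z powr (1 - s - 1))"
      using n by (intro MVT2) (auto intro!: derivative_eq_intros)
    then obtain z where z: "real n < z" "z < real (Suc n)"
      and eq: "real (Suc n) powr (1 - s) - real n powr (1 - s) = (1 - s) * z powr (- s)"
      by auto
    have "real (Suc n) powr (- s) \<le> z powr (- s)"
      using z s n by (intro powr_mono2') auto
    then have "(s - 1) * real (Suc n) powr (- s) \<le> (s - 1) * z powr (- s)"
      using s by (intro mult_left_mono) auto
    also have "\<dots> = real n powr (1 - s) - real (Suc n) powr (1 - s)"
      using eq by (simp add: algebra_simps)
    finally have "real (Suc n) powr (- s) \<le> (real n powr (1 - s) - real (Suc n) powr (1 - s)) / (s - 1)"
      using s by (simp add: field_simps)
    moreover have "(\<Sum>i=m+1..Suc n. real i powr (- s)) = (\<Sum>i=m+1..n. real i powr (- s)) + real (Suc n) powr (- s)"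
      using step by simp
    ultimately show ?case
      using step.IH by (simp add: diff_divide_distrib del: sum.cl_ivl_Suc)
  qed simp
  show ?thesis
  proof (cases "m \<le> n")
    case True
    have "(real m powr (1 - s) - real n powr (1 - s)) / (s - 1) \<le> real m powr (1 - s) / (s - 1)"
      using s by (intro divide_right_mono) auto
    with *[OF True] show ?thesis by simp
  qed (use s in simp)
qed

text \<open>
The logarithmic factor is frozen at its value in \<open>m\<close>, at the price of the factor \<open>(i / m)\<^sup>\<epsilon>\<close>; the remaining pure power
is still summable, and its tail restores the correct power of \<open>m\<close>.
\<close>

lemma sum_power_log_tail_le:
  assumes "1 < b"
  obtains C where "0 < C" and "\<And>m n. 1 \<le> m \<Longrightarrow> (\<Sum>i=m+1..n. power_log b a i) \<le> C * power_log (b - 1) a m"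
proof -
  \<comment> \<open>half of the room above the exponent of summability pays for the logarithm\<close>
  define \<epsilon> where "\<epsilon> = (b - 1) / 2"
  have \<epsilon>: "0 < \<epsilon>" "1 < b - \<epsilon>" using assms by (auto simp: \<epsilon>_def field_simps)
  obtain C where C: "0 < C" "\<And>m i. 1 \<le> m \<Longrightarrow> m \<le> i \<Longrightarrow>
    ln (real i + 1) powr (- a) \<le> C * (real i / real m) powr \<epsilon> * ln (real m + 1) powr (- a)"
    using ln_succ_powr_le[OF \<epsilon>(1), of a] by blast
  have "(\<Sum>i=m+1..n. power_log b a i) \<le> C / (b - \<epsilon> - 1) * power_log (b - 1) a m" if m: "1 \<le> m" for m n
  proof -
    define K where "K = C * real m powr (- \<epsilon>) * ln (real m + 1) powr (- a)"
    have "power_log b a i \<le> K * real i powr (- (b - \<epsilon>))" if "i \<in> {m+1..n}" for i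
    proof -
      have "power_log b a i \<le> real i powr (- b) * (C * (real i / real m) powr \<epsilon> * ln (real m + 1) powr (- a))"
        unfolding power_log_def using that m by (intro mult_left_mono C) auto
      also have "\<dots> = C * (real i powr (- b) * real i powr \<epsilon>) * real m powr (- \<epsilon>) * ln (real m + 1) powr (- a)"
        using that m by (simp add: powr_divide powr_minus field_simps)
      also have "real i powr (- b) * real i powr \<epsilon> = real i powr (- (b - \<epsilon>))"
        by (simp add: powr_add[symmetric])
      finally show ?thesis by (simp add: K_def mult_ac)
    qed
    then have "(\<Sum>i=m+1..n. power_log b a i) \<le> (\<Sum>i=m+1..n. K * real i powr (- (b - \<epsilon>)))"
      by (rule sum_mono)
    also have "\<dots> \<le> K * (real m powr (1 - (b - \<epsilon>)) / (b - \<epsilon> - 1))"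
      unfolding sum_distrib_left[symmetric] using C(1) m
      by (intro mult_left_mono sum_powr_tail_le \<epsilon>) (auto simp: K_def)
    also have "\<dots> = C / (b - \<epsilon> - 1) * ((real m powr (- \<epsilon>) * real m powr (1 - (b - \<epsilon>))) * ln (real m + 1) powr (- a))"
      by (simp add: K_def)
    also have "real m powr (- \<epsilon>) * real m powr (1 - (b - \<epsilon>)) = real m powr (- (b - 1))"
      by (simp add: powr_add[symmetric])
    finally show ?thesis by (simp add: power_log_def)
  qed
  moreover have "0 < C / (b - \<epsilon> - 1)" using C \<epsilon> by simp
  ultimately show thesis using that by blast
qed

lemma sqrt_power_log:
  "sqrt (power_log b a n) = real n powr (- b / 2) * ln (real n + 1) powr (- a / 2)"
  by (simp add: power_log_def real_sqrt_mult powr_half_sqrt[symmetric] powr_powr)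

lemma real_mult_power_log:
  assumes "1 \<le> n"
  shows "real n * power_log b a n = power_log (b - 1) a n"
  using assms by (simp add: power_log_def powr_mult_base mult.assoc[symmetric])

text \<open>
The ratio of the logarithms is at most the ratio of the arguments, so both factors change by at most a power
of \<open>K\<close>, whatever the sign of \<open>a\<close>.
\<close>

lemma power_log_le_of_comparable:
  assumes b: "0 \<le> b" and mq: "1 \<le> m" "m \<le> q" "real q \<le> K * real m"
  shows "power_log b a m \<le> K powr (b + \<bar>a\<bar>) * power_log b a q"
proof -
  define x where "x = real q / real m"
  define y where "y = ln (real q + 1) / ln (real m + 1)"
  have x: "1 \<le> x" "x \<le> K" using mq by (auto simp: x_def field_simps)
  have "y \<le> x" using mq ln_succ_ratio_le[of m q] by (simp only: y_def x_def)
  then have y: "1 \<le> y" "y \<le> K" using mq x by (auto simp: y_def le_divide_eq)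
  have "x powr b \<le> K powr b" using x b by (intro powr_mono2) auto
  moreover have "y powr a \<le> K powr \<bar>a\<bar>"
  proof -
    have "y powr a \<le> y powr \<bar>a\<bar>" using y by (intro powr_mono) auto
    also have "\<dots> \<le> K powr \<bar>a\<bar>" using y by (intro powr_mono2) auto
    finally show ?thesis .
  qed
  ultimately have "x powr b * y powr a \<le> K powr b * K powr \<bar>a\<bar>"
    by (intro mult_mono) auto
  then have "(x powr b * y powr a) * power_log b a q \<le> K powr (b + \<bar>a\<bar>) * power_log b a q"
    using mq power_log_pos[of q b a] by (intro mult_right_mono) (auto simp: powr_add)
  moreover have "(x powr b * y powr a) * power_log b a q = power_log b a m"
    using mq by (simp add: x_def y_def power_log_def powr_divide powr_minus field_simps)
  ultimately show ?thesis by simp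
qed

text \<open>
The limit gives the bounds for large indices, and positivity for the others. Replacing \<open>ln i\<close> by
\<open>ln (i + 1)\<close> does not change the limit and avoids the zero of \<open>ln\<close> at \<open>i = 1\<close>.
\<close>

lemma power_log_bounds_of_tendsto:
  assumes lim: "(\<lambda>i. lam i * real i powr b * ln (real i) powr a) \<longlonglongrightarrow> L" and L: "0 < L"
    and pos: "\<And>i. 1 \<le> i \<Longrightarrow> 0 < lam i"
  obtains c C where "0 < c" "0 < C" "\<And>i. 1 \<le> i \<Longrightarrow> c * power_log b a i \<le> lam i"
    "\<And>i. 1 \<le> i \<Longrightarrow> lam i \<le> C * power_log b a i"
proof -
  \<comment> \<open>the value at \<open>0\<close> is arbitrary, but nonzero so that \<open>f\<close> can be inverted everywhere\<close>
  define f where "f i = (if i = 0 then L else lam i / power_log b a i)" for i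
  have fpos: "0 < f i" for i
    using pos[of i] power_log_pos[of i b a] L by (auto simp: f_def)
  have "(\<lambda>i :: nat. ln (real i + 1) / ln (real i)) \<longlonglongrightarrow> 1" by real_asymp
  then have "(\<lambda>i :: nat. (ln (real i + 1) / ln (real i)) powr a) \<longlonglongrightarrow> 1 powr a"
    by (intro tendsto_intros) auto
  then have "(\<lambda>i. (lam i * real i powr b * ln (real i) powr a) * (ln (real i + 1) / ln (real i)) powr a) \<longlonglongrightarrow> L * 1 powr a"
    using lim by (intro tendsto_mult)
  moreover have "eventually (\<lambda>i. (lam i * real i powr b * ln (real i) powr a) * (ln (real i + 1) / ln (real i)) powr a = f i) sequentially"
    using eventually_ge_at_top[of 2]
    by eventually_elim (auto simp: f_def power_log_def powr_divide powr_minus field_simps)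
  ultimately have f: "f \<longlonglongrightarrow> L"
    by (simp add: filterlim_cong[OF refl refl])
  then obtain C where C: "0 < C" "\<And>i. norm (f i) \<le> C"
    using convergent_imp_Bseq[OF convergentI] BseqE by blast
  have "(\<lambda>i. inverse (f i)) \<longlonglongrightarrow> inverse L"
    using f L by (intro tendsto_intros) auto
  then obtain D where D: "0 < D" "\<And>i. norm (inverse (f i)) \<le> D"
    using convergent_imp_Bseq[OF convergentI] BseqE by blast
  have "lam i \<le> C * power_log b a i" if "1 \<le> i" for i
    using C(2)[of i] fpos[of i] that power_log_pos[OF that, of b a] by (simp add: f_def field_simps)
  moreover have "inverse D * power_log b a i \<le> lam i" if "1 \<le> i" for i
    using D(2)[of i] D(1) fpos[of i] that power_log_pos[OF that, of b a] pos[OF that]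
    by (simp add: f_def field_simps)
  ultimately show thesis using that[of "inverse D" C] C D by auto
qed

section \<open>The allocation of bits\<close>

text \<open>
This is \<open>m! \<ge> (m / e)\<^sup>m\<close>. It is the reason why the total number of bits is only linear in \<open>m\<close>.
\<close>

lemma sum_ln_ratio_le:
  assumes "1 \<le> m"
  shows "(\<Sum>i=1..m. ln (real m / real i)) \<le> real m"
proof -
  have "(\<Sum>i=1..m. ln (real i)) \<ge> real m * ln (real m) - real m"
    using assms
  proof (induction rule: dec_induct)
    case (step n)
    have n: "1 \<le> real n" using step by simp
    have "ln (real n + 1) - ln (real n) = ln ((real n + 1) / real n)" using n by (simp add: ln_div)
    also have "\<dots> \<le> (real n + 1) / real n - 1" using n by (intro ln_le_minus_one) simp
    also have "\<dots> = 1 / real n" using n by (simp add: field_simps)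
    finally have "real n * (ln (real n + 1) - ln (real n)) \<le> real n * (1 / real n)"
      using n by (intro mult_left_mono) auto
    then have "real n * ln (real n + 1) \<le> real n * ln (real n) + 1"
      using n by (simp add: algebra_simps)
    with step.IH show ?case by (simp add: algebra_simps)
  qed simp
  moreover have "(\<Sum>i=1..m. ln (real m / real i)) = (\<Sum>i=1..m. ln (real m) - ln (real i))"
    using assms by (intro sum.cong) (auto simp: ln_div)
  ultimately show ?thesis by (simp add: sum_subtractf)
qed

lemma bit_budget_bounds:
  assumes "1 < \<beta>" "1 \<le> i" "i \<le> m"
  shows "0 \<le> bit_budget \<alpha> \<beta> m i"
    and "bit_budget \<alpha> \<beta> m i \<le> (\<beta> + max \<alpha> 0) * log 2 (real m / real i)"
proof -
  have eq: "log 2 (real m + 1) / log 2 (real i + 1) = ln (real m + 1) / ln (real i + 1)"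
    by (simp add: log_def)
  have 1: "1 \<le> ln (real m + 1) / ln (real i + 1)" using assms by (simp add: le_divide_eq)
  have "1 \<le> real m / real i" using assms by simp
  then show "0 \<le> bit_budget \<alpha> \<beta> m i"
    unfolding bit_budget_def eq using 1 assms by (intro add_nonneg_nonneg mult_nonneg_nonneg) auto
  have "log 2 (ln (real m + 1) / ln (real i + 1)) \<le> log 2 (real m / real i)"
    using 1 assms ln_succ_ratio_le[of i m] by (subst log_le_cancel_iff) auto
  then show "bit_budget \<alpha> \<beta> m i \<le> (\<beta> + max \<alpha> 0) * log 2 (real m / real i)"
    unfolding bit_budget_def eq distrib_right by (intro add_left_mono mult_left_mono) auto
qed

lemma bit_number_bounds:
  "1 \<le> bit_number \<alpha> \<beta> m i" "bit_budget \<alpha> \<beta> m i \<le> bit_number \<alpha> \<beta> m i"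
  "real (bit_number \<alpha> \<beta> m i) \<le> max (bit_budget \<alpha> \<beta> m i) 1 + 1"
  unfolding bit_number_def by linarith+

lemma total_bits_ge: "m \<le> total_bits m (bit_number \<alpha> \<beta> m)"
proof -
  have "(\<Sum>i=1..m. 1) \<le> total_bits m (bit_number \<alpha> \<beta> m)"
    unfolding total_bits_def by (intro sum_mono bit_number_bounds)
  then show ?thesis by simp
qed

lemma total_bits_le:
  assumes "1 < \<beta>" "1 \<le> m"
  shows "real (total_bits m (bit_number \<alpha> \<beta> m)) \<le> (2 * (\<beta> + max \<alpha> 0) + 2) * real m"
proof -
  define c where "c = \<beta> + max \<alpha> 0"
  have c: "0 < c" using assms by (simp add: c_def)
  have "real (total_bits m (bit_number \<alpha> \<beta> m)) \<le> (\<Sum>i=1..m. c * log 2 (real m / real i) + 2)"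
    unfolding total_bits_def of_nat_sum
  proof (rule sum_mono)
    fix i assume "i \<in> {1..m}"
    then show "real (bit_number \<alpha> \<beta> m i) \<le> c * log 2 (real m / real i) + 2"
      using bit_budget_bounds[of \<beta> i m \<alpha>] bit_number_bounds(3)[of \<alpha> \<beta> m i] assms by (simp add: c_def)
  qed
  also have "\<dots> = c * ((\<Sum>i=1..m. ln (real m / real i)) / ln 2) + 2 * real m"
    by (simp add: sum.distrib log_def sum_distrib_left sum_divide_distrib)
  also have "(\<Sum>i=1..m. ln (real m / real i)) / ln 2 \<le> real m / (1 / 2)"
    using sum_ln_ratio_le[OF assms(2)] ln2_ge_two_thirds by (intro frac_le) auto
  finally show ?thesis
    using c by (simp add: c_def[symmetric] mult_left_mono algebra_simps)
qed

text \<open>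
The bit numbers are designed for this: \<open>2\<close> to the power \<open>bit_budget \<alpha> \<beta> m i\<close> is \<open>x\<^sup>\<beta> y\<^sup>\<alpha>\<close> with \<open>x\<close>, \<open>y\<close> the ratios of
the arguments and of their logarithms, so that all coordinates contribute equally. For \<open>\<alpha> < 0\<close> the budget omits
\<open>y\<^sup>\<alpha>\<close>, a factor of at most one.
\<close>

lemma power_log_div_bits_le:
  assumes "1 \<le> i" "i \<le> m"
  shows "power_log \<beta> \<alpha> i / 2 ^ bit_number \<alpha> \<beta> m i \<le> power_log \<beta> \<alpha> m"
proof -
  define x where "x = real m / real i"
  define y where "y = ln (real m + 1) / ln (real i + 1)"
  have x: "1 \<le> x" and y: "1 \<le> y" using assms by (auto simp: x_def y_def le_divide_eq)
  have "x powr \<beta> * y powr max \<alpha> 0 = 2 powr bit_budget \<alpha> \<beta> m i"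
  proof -
    have "log 2 (real m + 1) / log 2 (real i + 1) = y" by (simp add: log_def y_def)
    then have "2 powr bit_budget \<alpha> \<beta> m i = (2 powr log 2 x) powr \<beta> * (2 powr log 2 y) powr max \<alpha> 0"
      by (simp add: bit_budget_def x_def powr_add powr_powr mult.commute)
    then show ?thesis using x y by simp
  qed
  also have "\<dots> \<le> 2 powr real (bit_number \<alpha> \<beta> m i)"
    by (intro powr_mono bit_number_bounds) simp
  also have "\<dots> = 2 ^ bit_number \<alpha> \<beta> m i" by (simp add: powr_realpow)
  finally have 1: "x powr \<beta> * y powr max \<alpha> 0 \<le> 2 ^ bit_number \<alpha> \<beta> m i" .
  have "power_log \<beta> \<alpha> i = (x powr \<beta> * y powr \<alpha>) * power_log \<beta> \<alpha> m"
    using assms by (simp add: x_def y_def power_log_def powr_divide powr_minus field_simps)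
  also have "\<dots> \<le> (x powr \<beta> * y powr max \<alpha> 0) * power_log \<beta> \<alpha> m"
    using y assms power_log_pos[of m \<beta> \<alpha>] by (intro mult_right_mono mult_left_mono powr_mono) auto
  also have "\<dots> \<le> 2 ^ bit_number \<alpha> \<beta> m i * power_log \<beta> \<alpha> m"
    using 1 assms power_log_pos[of m \<beta> \<alpha>] by (intro mult_right_mono) auto
  finally show ?thesis by (simp add: divide_le_eq mult.commute)
qed

section \<open>Random bit measures and the Wasserstein distance\<close>

text \<open>
In a second countable space the complement of the support is a countable union of null sets, namely of the basic
open sets of measure zero.
\<close>

lemma AE_in_measure_support:
  fixes \<nu> :: "'a::second_countable_topology measure"
  assumes [measurable_cong]: "sets \<nu> = sets borel"
  shows "AE x in \<nu>. x \<in> measure_support \<nu>"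
proof -
  obtain B :: "'a set set" where B: "countable B" "topological_basis B"
    using ex_countable_basis by blast
  define N where "N = {U \<in> B. emeasure \<nu> U = 0}"
  have "AE x in \<nu>. \<forall>U\<in>N. x \<notin> U"
  proof (subst AE_ball_countable)
    show "countable N" using B(1) by (simp add: N_def)
    show "\<forall>U\<in>N. AE x in \<nu>. x \<notin> U"
    proof
      fix U assume "U \<in> N"
      then have "open U" "emeasure \<nu> U = 0"
        using B(2) by (auto simp: N_def topological_basis_open)
      then have "U \<in> null_sets \<nu>" by (intro null_setsI) (simp_all add: assms)
      then show "AE x in \<nu>. x \<notin> U" by (rule AE_not_in)
    qed
  qed
  moreover have "x \<in> measure_support \<nu>" if x: "\<forall>U\<in>N. x \<notin> U" for x
    unfolding measure_support_def
  proof (intro CollectI allI impI)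
    fix U assume U: "open U" "x \<in> U"
    then obtain V where V: "V \<in> B" "x \<in> V" "V \<subseteq> U"
      using B(2) by (metis topological_basisE)
    then have "emeasure \<nu> V \<noteq> 0" using x by (auto simp: N_def)
    moreover have "emeasure \<nu> V \<le> emeasure \<nu> U"
      using V(3) U(1) by (intro emeasure_mono) (simp_all add: assms)
    ultimately show "0 < emeasure \<nu> U"
      by (metis le_zero_eq not_gr_zero)
  qed
  ultimately show ?thesis by (auto elim: eventually_mono)
qed

lemma card_bit_strings: "card ({1..p} \<rightarrow>\<^sub>E {0, 1 :: nat}) = 2 ^ p"
  by (simp add: card_PiE numeral_2_eq_2)

lemma finite_bit_strings: "finite ({1..p :: nat} \<rightarrow>\<^sub>E {0, 1 :: nat})"
  by (intro finite_PiE) auto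

lemma random_bit_measures_subset_finite_support:
  "random_bit_measures p \<subseteq>
     (finite_support_measures p :: 'a::{banach, second_countable_topology} measure set)"
proof
  fix \<nu> :: "'a measure"
  define B where "B = {1..p} \<rightarrow>\<^sub>E {0, 1 :: nat}"
  assume \<nu>: "\<nu> \<in> random_bit_measures p"
  then obtain f where f: "\<nu> = distr (uniform_count_measure B) borel f"
    by (auto simp: random_bit_measures_def B_def)
  have B: "finite B" "card B = 2 ^ p"
    unfolding B_def by (rule finite_bit_strings card_bit_strings)+
  have supp: "measure_support \<nu> \<subseteq> f ` B"
  proof
    fix x assume x: "x \<in> measure_support \<nu>"
    have op: "open (- f ` B)" using B by (simp add: finite_imp_closed open_Compl)
    have "f -` (- f ` B) \<inter> space (uniform_count_measure B) = {}"
      by (auto simp: space_uniform_count_measure)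
    then have "emeasure \<nu> (- f ` B) = 0"
      unfolding f using borel_open[OF op]
      by (subst emeasure_distr) (auto simp: space_uniform_count_measure sets_uniform_count_measure measurable_def)
    with op show "x \<in> f ` B" using x by (auto simp: measure_support_def)
  qed
  then have "finite (measure_support \<nu>)" using B by (auto intro: finite_subset)
  moreover have "card (measure_support \<nu>) \<le> 2 ^ p"
    using card_mono[OF _ supp] card_image_le[OF B(1), of f] B by simp
  ultimately show "\<nu> \<in> finite_support_measures p"
    using \<nu> random_bit_measures_subset by (auto simp: finite_support_measures_def)
qed

lemma random_bit_measures_nonempty: "random_bit_measures p \<noteq> {}"
  by (auto simp: random_bit_measures_def)

lemma wasserstein2_geI:
  assumes "\<mu> \<in> second_moment_measures" "\<nu> \<in> second_moment_measures"
    and "\<And>c. c \<in> coupling_costs \<mu> \<nu> \<Longrightarrow> b \<le> c"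
  shows "b \<le> wasserstein2 \<mu> \<nu>"
  unfolding wasserstein2_def using assms coupling_costs_nonempty by (intro cInf_greatest)

lemma wasserstein2_nonneg:
  assumes "\<mu> \<in> second_moment_measures" "\<nu> \<in> second_moment_measures"
  shows "0 \<le> wasserstein2 \<mu> \<nu>"
  using assms by (rule wasserstein2_geI) (auto simp: coupling_costs_def)

lemma bdd_below_wasserstein2:
  assumes "\<mu> \<in> second_moment_measures" "A \<subseteq> second_moment_measures"
  shows "bdd_below (wasserstein2 \<mu> ` A)"
  using assms by (intro bdd_belowI2[where m = 0] wasserstein2_nonneg) auto

lemma quant_le_rbit:
  assumes "\<mu> \<in> second_moment_measures"
  shows "quant \<mu> p \<le> rbit \<mu> p"
  unfolding quant_def rbit_def
  using assms random_bit_measures_subset_finite_support random_bit_measures_nonempty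
  by (intro cINF_superset_mono bdd_below_wasserstein2) (auto simp: finite_support_measures_def)

lemma rbit_le_coupling:
  fixes X Z :: "'w \<Rightarrow> 'a::{banach, second_countable_topology}"
  assumes "prob_space M" "X \<in> borel_measurable M" "Z \<in> borel_measurable M"
    and "distr M borel X \<in> second_moment_measures" "distr M borel Z \<in> random_bit_measures p"
  shows "rbit (distr M borel X) p \<le> sqrt (\<integral>\<omega>. (norm (X \<omega> - Z \<omega>))\<^sup>2 \<partial>M)"
proof -
  have "rbit (distr M borel X) p \<le> wasserstein2 (distr M borel X) (distr M borel Z)"
    unfolding rbit_def
    using assms(4,5) random_bit_measures_subset by (intro cINF_lower bdd_below_wasserstein2)
  also have "\<dots> \<le> sqrt (\<integral>\<omega>. (norm (X \<omega> - Z \<omega>))\<^sup>2 \<partial>M)"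
    unfolding wasserstein2_def using assms
    by (intro cInf_lower coupling_costs_any_space coupling_costs_bdd_below) auto
  finally show ?thesis .
qed

text \<open>
Bit strings may be replaced by any uniform variable on a set of \<open>2\<^sup>p\<close> elements, because only the cardinality of
the sample space matters. It is applied to the vector of the cell numbers of several normal variables.
\<close>

lemma distr_uniform_in_random_bit_measures:
  fixes g :: "'s \<Rightarrow> 'a::{banach, second_countable_topology}"
  assumes S: "finite S" "card S = 2 ^ p" and K: "K \<in> measurable M (count_space S)"
    and unif: "\<And>s. s \<in> S \<Longrightarrow> emeasure M (K -` {s} \<inter> space M) = ennreal (1 / 2 ^ p)"
  shows "distr M borel (\<lambda>\<omega>. g (K \<omega>)) \<in> random_bit_measures p"
proof -
  define B where "B = {1..p} \<rightarrow>\<^sub>E {0, 1 :: nat}"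
  have B: "finite B" "card B = 2 ^ p"
    unfolding B_def by (rule finite_bit_strings card_bit_strings)+
  then obtain h where h: "bij_betw h B S"
    using S finite_same_card_bij by metis
  then have hm: "h \<in> measurable (uniform_count_measure B) (count_space S)"
    by (auto simp: measurable_def space_uniform_count_measure sets_uniform_count_measure bij_betw_def)
  have "distr M (count_space S) K = distr (uniform_count_measure B) (count_space S) h"
  proof (rule measure_eqI_finite[where A = S])
    fix s assume s: "s \<in> S"
    then obtain b where b: "b \<in> B" "h -` {s} \<inter> B = {b}"
      using h by (auto simp: bij_betw_def inj_on_def)
    have "emeasure (distr (uniform_count_measure B) (count_space S) h) {s}
        = emeasure (uniform_count_measure B) {b}"
      using hm s b by (subst emeasure_distr) (auto simp: space_uniform_count_measure)
    also have "\<dots> = ennreal (1 / 2 ^ p)"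
      using B b by (simp add: emeasure_uniform_count_measure)
    also have "\<dots> = emeasure (distr M (count_space S) K) {s}"
      using K s by (simp add: emeasure_distr unif)
    finally show "emeasure (distr M (count_space S) K) {s}
        = emeasure (distr (uniform_count_measure B) (count_space S) h) {s}" ..
  qed (use S in auto)
  then have "distr (distr M (count_space S) K) borel g
      = distr (distr (uniform_count_measure B) (count_space S) h) borel g" by simp
  then have "distr M borel (\<lambda>\<omega>. g (K \<omega>)) = distr (uniform_count_measure B) borel (\<lambda>b. g (h b))"
    using K hm by (simp add: distr_distr comp_def)
  then show ?thesis unfolding random_bit_measures_def B_def by blast
qed

section \<open>Small balls and quantization\<close>

text \<open>
The \<open>2\<^sup>p\<close> balls of squared radius \<open>R\<close> around the support of \<open>\<nu>\<close> have total mass at most \<open>2\<^sup>p / 4\<^sup>p \<le> 1/2\<close>, so in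
every coupling the two variables are further apart than \<open>sqrt R\<close> with probability at least \<open>1/2\<close>.
\<close>

lemma quant_ge_of_small_balls:
  fixes \<mu> :: "'a::{banach, second_countable_topology} measure"
  assumes \<mu>: "\<mu> \<in> second_moment_measures" and p: "1 \<le> p" and R: "0 \<le> R"
    and small: "\<And>a. measure \<mu> (cball a (sqrt R)) \<le> 1 / 4 ^ p"
  shows "sqrt (R / 2) \<le> quant \<mu> p"
  unfolding quant_def
proof (rule cINF_greatest)
  show "finite_support_measures p \<noteq> {}"
    using random_bit_measures_subset_finite_support random_bit_measures_nonempty by blast
next
  fix \<nu> :: "'a measure" assume "\<nu> \<in> finite_support_measures p"
  then have \<nu>: "\<nu> \<in> second_moment_measures"
    and supp: "finite (measure_support \<nu>)" "card (measure_support \<nu>) \<le> 2 ^ p"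
    by (auto simp: finite_support_measures_def)
  show "sqrt (R / 2) \<le> wasserstein2 \<mu> \<nu>"
  proof (rule wasserstein2_geI[OF \<mu> \<nu>])
    fix c assume "c \<in> coupling_costs \<mu> \<nu>"
    then obtain N :: "('a \<times> 'a) measure" and X1 X2
      where c: "c = sqrt (\<integral>\<omega>. (norm (X1 \<omega> - X2 \<omega>))\<^sup>2 \<partial>N)" and N: "prob_space N"
        and X [measurable]: "X1 \<in> borel_measurable N" "X2 \<in> borel_measurable N"
        and laws: "distr N borel X1 = \<mu>" "distr N borel X2 = \<nu>"
      by (auto simp: coupling_costs_def)
    interpret N: prob_space N by (rule N)
    define E where "E = (\<Union>a\<in>measure_support \<nu>. X1 -` cball a (sqrt R) \<inter> space N)"
    have E [measurable]: "E \<in> sets N"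
      unfolding E_def using supp by (intro sets.finite_UN measurable_sets[OF X(1)]) auto
    have "N.prob E \<le> (\<Sum>a\<in>measure_support \<nu>. N.prob (X1 -` cball a (sqrt R) \<inter> space N))"
      unfolding E_def using supp
      by (intro N.finite_measure_subadditive_finite) (auto intro!: measurable_sets[OF X(1)])
    also have "\<dots> = (\<Sum>a\<in>measure_support \<nu>. measure \<mu> (cball a (sqrt R)))"
      by (intro sum.cong refl) (simp add: laws(1)[symmetric] measure_distr)
    also have "\<dots> \<le> (\<Sum>a\<in>measure_support \<nu>. 1 / 4 ^ p)"
      by (intro sum_mono small)
    also have "\<dots> \<le> 2 ^ p * (1 / 4 ^ p)"
    proof -
      have "real (card (measure_support \<nu>)) \<le> 2 ^ p"
        using of_nat_mono[OF supp(2), where 'a = real] by simp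
      then show ?thesis by (simp add: divide_right_mono)
    qed
    also have "\<dots> = (1 / 2) ^ p"
      by (simp add: power_divide[symmetric] flip: power_mult_distrib)
    also have "\<dots> \<le> (1 / 2) ^ 1"
      using p by (intro power_decreasing) auto
    finally have half: "1 / 2 \<le> N.prob (space N - E)"
      by (simp add: N.prob_compl)
    have "AE \<omega> in N. X2 \<omega> \<in> measure_support \<nu>"
    proof -
      have "sets \<nu> = sets borel" using \<nu> by (simp add: second_moment_measures_def)
      then have "AE x in distr N borel X2. x \<in> measure_support \<nu>"
        unfolding laws(2) by (rule AE_in_measure_support)
      then show ?thesis by (rule AE_distrD[OF X(2)])
    qed
    then have "AE \<omega> in N. R * indicator (space N - E) \<omega> \<le> (norm (X1 \<omega> - X2 \<omega>))\<^sup>2"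
    proof eventually_elim
      case (elim \<omega>)
      show ?case
      proof (cases "\<omega> \<in> space N - E")
        case True
        with elim have "X1 \<omega> \<notin> cball (X2 \<omega>) (sqrt R)" by (auto simp: E_def)
        then have "sqrt R \<le> norm (X1 \<omega> - X2 \<omega>)" by (simp add: dist_norm norm_minus_commute)
        then have "(sqrt R)\<^sup>2 \<le> (norm (X1 \<omega> - X2 \<omega>))\<^sup>2" using R by (intro power_mono) auto
        then show ?thesis using True R by simp
      qed simp
    qed
    moreover have "integrable N (\<lambda>\<omega>. (norm (X1 \<omega> - X2 \<omega>))\<^sup>2)"
      using \<mu> \<nu> laws by (intro integrable_coupling) simp_all
    moreover have "integrable N (indicator (space N - E) :: _ \<Rightarrow> real)"
      by (intro integrable_real_indicator) (auto simp: N.emeasure_finite less_top[symmetric])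
    ultimately have "(\<integral>\<omega>. R * indicator (space N - E) \<omega> \<partial>N) \<le> (\<integral>\<omega>. (norm (X1 \<omega> - X2 \<omega>))\<^sup>2 \<partial>N)"
      by (intro integral_mono_AE) auto
    then have "R * N.prob (space N - E) \<le> (\<integral>\<omega>. (norm (X1 \<omega> - X2 \<omega>))\<^sup>2 \<partial>N)"
      by simp
    moreover have "R * (1 / 2) \<le> R * N.prob (space N - E)"
      using half R by (rule mult_left_mono)
    ultimately show "sqrt (R / 2) \<le> c" unfolding c by (intro real_sqrt_le_mono) simp
  qed
qed

text \<open>
Bounding the normal density by its maximum leaves a Gaussian integral that depends on the centre \<open>a\<close> only
by translation.
\<close>

lemma nn_integral_exp_std_normal_le:
  assumes t: "0 < t"
  shows "(\<integral>\<^sup>+y. ennreal (exp (- (y - a)\<^sup>2 / t)) \<partial>std_normal_distribution) \<le> ennreal (sqrt (t / 2))"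
proof -
  have "(\<integral>\<^sup>+y. ennreal (exp (- (y - a)\<^sup>2 / t)) \<partial>std_normal_distribution)
      = (\<integral>\<^sup>+y. ennreal (std_normal_density y) * ennreal (exp (- (y - a)\<^sup>2 / t)) \<partial>lborel)"
    by (subst nn_integral_density) auto
  also have "\<dots> \<le> (\<integral>\<^sup>+y. ennreal (sqrt (t / 2)) * ennreal (normal_density a (sqrt (t / 2)) y) \<partial>lborel)"
  proof (rule nn_integral_mono)
    fix y :: real
    have "std_normal_density y \<le> 1 / sqrt (2 * pi)"
      by (simp add: std_normal_density_def divide_right_mono)
    then have "std_normal_density y * exp (- (y - a)\<^sup>2 / t) \<le> 1 / sqrt (2 * pi) * exp (- (y - a)\<^sup>2 / t)"
      by (rule mult_right_mono) simp
    also have "\<dots> = sqrt (t / 2) * normal_density a (sqrt (t / 2)) y"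
      using t by (simp add: normal_density_def real_sqrt_mult real_sqrt_divide field_simps)
    finally show "ennreal (std_normal_density y) * ennreal (exp (- (y - a)\<^sup>2 / t))
        \<le> ennreal (sqrt (t / 2)) * ennreal (normal_density a (sqrt (t / 2)) y)"
      using t by (simp add: ennreal_mult[symmetric] ennreal_leI)
  qed
  also have "\<dots> = ennreal (sqrt (t / 2)) * 1"
    using t by (subst nn_integral_cmult) (auto simp: nn_integral_eq_integral)
  finally show ?thesis by simp
qed

text \<open>
The exponential Markov inequality with parameter \<open>128\<close>: on the event, \<open>n - 128 * \<Sum> (Y\<^sub>i - a\<^sub>i)\<^sup>2\<close> is nonnegative, and
the expectation of its exponential is a product with factors at most \<open>e / 16 \<le> 1/4\<close>. The radius is
chosen so small that the bound beats the number \<open>2\<^sup>n\<close> of points.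
\<close>

lemma (in prob_space) std_normal_small_ball:
  assumes indep: "indep_vars (\<lambda>_. borel) Y {1..n}"
    and normal: "\<And>i. i \<in> {1..n} \<Longrightarrow> distributed M lborel (Y i) std_normal_density"
  shows "emeasure M {\<omega>\<in>space M. (\<Sum>i=1..n. (Y i \<omega> - a i)\<^sup>2) \<le> n / 128} \<le> ennreal (1 / 4 ^ n)"
proof -
  define Z where "Z i \<omega> = exp (- (Y i \<omega> - a i)\<^sup>2 / (1 / 128))" for i \<omega>
  have Y [measurable]: "Y i \<in> borel_measurable M" if "i \<in> {1..n}" for i
    using distributed_measurable[OF normal[OF that]] by simp
  have Z: "(\<integral>\<^sup>+\<omega>. ennreal (Z i \<omega>) \<partial>M) \<le> ennreal (1 / 16)" if i: "i \<in> {1..n}" for i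
  proof -
    have "std_normal_distribution = distr M lborel (Y i)"
      using distributed_distr_eq_density[OF normal[OF i]] by simp
    then have "(\<integral>\<^sup>+\<omega>. ennreal (Z i \<omega>) \<partial>M)
        = (\<integral>\<^sup>+y. ennreal (exp (- (y - a i)\<^sup>2 / (1 / 128))) \<partial>std_normal_distribution)"
      using Y[OF i] by (simp add: nn_integral_distr Z_def)
    also have "\<dots> \<le> ennreal (sqrt (1 / 128 / 2))" by (rule nn_integral_exp_std_normal_le) simp
    also have "sqrt (1 / 128 / 2) = sqrt ((1 / 16)\<^sup>2)" by (simp add: power2_eq_square)
    also have "\<dots> = 1 / 16" by (subst real_sqrt_abs) simp
    finally show ?thesis .
  qed
  have "indep_vars (\<lambda>_. borel) (\<lambda>i \<omega>. ennreal (Z i \<omega>)) {1..n}"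
    unfolding Z_def using indep
    by (rule indep_vars_compose2[where Y = "\<lambda>i y. ennreal (exp (- (y - a i)\<^sup>2 / (1 / 128)))"]) measurable
  then have prod: "(\<integral>\<^sup>+\<omega>. (\<Prod>i\<in>{1..n}. ennreal (Z i \<omega>)) \<partial>M) = (\<Prod>i\<in>{1..n}. \<integral>\<^sup>+\<omega>. ennreal (Z i \<omega>) \<partial>M)"
    by (intro indep_vars_nn_integral) auto
  let ?A = "{\<omega>\<in>space M. (\<Sum>i=1..n. (Y i \<omega> - a i)\<^sup>2) \<le> n / 128}"
  have [measurable]: "?A \<in> sets M" by measurable
  have "indicator ?A \<omega> \<le> ennreal (exp n) * (\<Prod>i\<in>{1..n}. ennreal (Z i \<omega>))" for \<omega>
  proof (cases "\<omega> \<in> ?A")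
    case True
    have "(\<Sum>i=1..n. - (Y i \<omega> - a i)\<^sup>2 / (1 / 128)) = - 128 * (\<Sum>i=1..n. (Y i \<omega> - a i)\<^sup>2)"
      by (simp add: sum_distrib_left sum_negf mult.commute)
    then have "exp n * (\<Prod>i\<in>{1..n}. Z i \<omega>) = exp (n - 128 * (\<Sum>i=1..n. (Y i \<omega> - a i)\<^sup>2))"
      unfolding Z_def by (simp only: exp_sum[symmetric] finite_atLeastAtMost exp_add[symmetric]) simp
    moreover have "0 \<le> n - 128 * (\<Sum>i=1..n. (Y i \<omega> - a i)\<^sup>2)" using True by simp
    ultimately have "1 \<le> exp n * (\<Prod>i\<in>{1..n}. Z i \<omega>)" by simp
    then show ?thesis
      using True by (simp add: prod_ennreal Z_def ennreal_mult[symmetric] prod_nonneg)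
  qed simp
  then have "(\<integral>\<^sup>+\<omega>. indicator ?A \<omega> \<partial>M) \<le> (\<integral>\<^sup>+\<omega>. ennreal (exp n) * (\<Prod>i\<in>{1..n}. ennreal (Z i \<omega>)) \<partial>M)"
    by (intro nn_integral_mono)
  also have "\<dots> = ennreal (exp n) * (\<Prod>i\<in>{1..n}. \<integral>\<^sup>+\<omega>. ennreal (Z i \<omega>) \<partial>M)"
  proof -
    have "(\<lambda>\<omega>. \<Prod>i\<in>{1..n}. ennreal (Z i \<omega>)) \<in> borel_measurable M"
      unfolding Z_def by measurable
    then show ?thesis by (simp only: nn_integral_cmult prod)
  qed
  also have "\<dots> \<le> ennreal (exp n) * (\<Prod>i\<in>{1..n}. ennreal (1 / 16))"
    by (intro mult_left_mono prod_mono_ennreal Z) auto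
  also have "\<dots> = ennreal (exp n * (1 / 16) ^ n)"
    by (simp add: ennreal_power ennreal_mult[symmetric])
  also have "exp (real n) * (1 / 16) ^ n = (exp 1 / 16) ^ n"
    using exp_of_nat_mult[of n "1 :: real"] by (simp add: power_divide)
  also have "\<dots> \<le> ennreal ((1 / 4) ^ n)"
    using exp_le by (intro ennreal_leI power_mono) auto
  finally show ?thesis by (simp add: power_divide)
qed

section \<open>Karhunen-Loeve expansions\<close>

lemma norm_sum_orthonormal_sq:
  fixes e :: "'i \<Rightarrow> 'a::real_inner"
  assumes "finite I" and orth: "\<And>i j. i \<in> I \<Longrightarrow> j \<in> I \<Longrightarrow> e i \<bullet> e j = (if i = j then 1 else 0)"
  shows "(norm (\<Sum>i\<in>I. c i *\<^sub>R e i))\<^sup>2 = (\<Sum>i\<in>I. (c i)\<^sup>2)"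
proof -
  have "(norm (\<Sum>i\<in>I. c i *\<^sub>R e i))\<^sup>2 = (\<Sum>i\<in>I. \<Sum>j\<in>I. c i * (c j * (e j \<bullet> e i)))"
    by (simp add: power2_norm_eq_inner inner_sum_left inner_sum_right sum_distrib_left)
  also have "\<dots> = (\<Sum>i\<in>I. \<Sum>j\<in>I. if i = j then c i * c j else 0)"
    by (intro sum.cong refl) (auto simp: orth)
  finally show ?thesis
    using assms(1) by (simp add: sum.delta power2_eq_square)
qed

lemma bessel_inequality:
  fixes e :: "'i \<Rightarrow> 'a::real_inner"
  assumes "finite I" and orth: "\<And>i j. i \<in> I \<Longrightarrow> j \<in> I \<Longrightarrow> e i \<bullet> e j = (if i = j then 1 else 0)"
  shows "(\<Sum>i\<in>I. (x \<bullet> e i)\<^sup>2) \<le> (norm x)\<^sup>2"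
proof -
  let ?s = "\<Sum>i\<in>I. (x \<bullet> e i) *\<^sub>R e i"
  have "x \<bullet> ?s = (\<Sum>i\<in>I. (x \<bullet> e i)\<^sup>2)"
    by (simp add: inner_sum_right power2_eq_square)
  moreover have "?s \<bullet> ?s = (\<Sum>i\<in>I. (x \<bullet> e i)\<^sup>2)"
    using norm_sum_orthonormal_sq[OF assms, of "\<lambda>i. x \<bullet> e i"] by (simp add: power2_norm_eq_inner)
  moreover have "0 \<le> (x - ?s) \<bullet> (x - ?s)" by simp
  moreover have "(x - ?s) \<bullet> (x - ?s) = x \<bullet> x - 2 * (x \<bullet> ?s) + ?s \<bullet> ?s"
    by (simp only: inner_diff_left inner_diff_right inner_commute[of ?s x])
  ultimately show ?thesis by (simp add: power2_norm_eq_inner)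
qed

lemma norm_add_sq_le:
  fixes x y :: "'a::real_normed_vector"
  shows "(norm (x + y))\<^sup>2 \<le> 2 * (norm x)\<^sup>2 + 2 * (norm y)\<^sup>2"
proof -
  have "(norm (x + y))\<^sup>2 \<le> (norm x + norm y)\<^sup>2"
    by (intro power_mono norm_triangle_ineq) simp
  also have "\<dots> \<le> 2 * (norm x)\<^sup>2 + 2 * (norm y)\<^sup>2"
    using zero_le_power2[of "norm x - norm y"] by (simp add: power2_eq_square algebra_simps)
  finally show ?thesis .
qed

lemma nn_integral_norm_add_sq_le:
  fixes F G :: "'w \<Rightarrow> 'a::{banach, second_countable_topology}"
  assumes [measurable]: "F \<in> borel_measurable M" "G \<in> borel_measurable M"
  shows "(\<integral>\<^sup>+\<omega>. ennreal ((norm (F \<omega> + G \<omega>))\<^sup>2) \<partial>M)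
    \<le> 2 * (\<integral>\<^sup>+\<omega>. ennreal ((norm (F \<omega>))\<^sup>2) \<partial>M) + 2 * (\<integral>\<^sup>+\<omega>. ennreal ((norm (G \<omega>))\<^sup>2) \<partial>M)"
proof -
  have "(\<integral>\<^sup>+\<omega>. ennreal ((norm (F \<omega> + G \<omega>))\<^sup>2) \<partial>M)
      \<le> (\<integral>\<^sup>+\<omega>. 2 * ennreal ((norm (F \<omega>))\<^sup>2) + 2 * ennreal ((norm (G \<omega>))\<^sup>2) \<partial>M)"
  proof (intro nn_integral_mono)
    fix \<omega>
    have "ennreal ((norm (F \<omega> + G \<omega>))\<^sup>2) \<le> ennreal (2 * (norm (F \<omega>))\<^sup>2 + 2 * (norm (G \<omega>))\<^sup>2)"
      by (intro ennreal_leI norm_add_sq_le)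
    then show "ennreal ((norm (F \<omega> + G \<omega>))\<^sup>2) \<le> 2 * ennreal ((norm (F \<omega>))\<^sup>2) + 2 * ennreal ((norm (G \<omega>))\<^sup>2)"
      by (simp add: ennreal_mult)
  qed
  also have "\<dots> = 2 * (\<integral>\<^sup>+\<omega>. ennreal ((norm (F \<omega>))\<^sup>2) \<partial>M) + 2 * (\<integral>\<^sup>+\<omega>. ennreal ((norm (G \<omega>))\<^sup>2) \<partial>M)"
    by (subst nn_integral_add) (auto simp: nn_integral_cmult)
  finally show ?thesis .
qed

lemma nn_integral_std_normal_sq: "(\<integral>\<^sup>+y. ennreal (y\<^sup>2) \<partial>std_normal_distribution) = ennreal 1"
proof -
  have "(\<integral>\<^sup>+y. ennreal (y\<^sup>2) \<partial>std_normal_distribution) = ennreal (\<integral>y. y ^ (2 * 1) \<partial>std_normal_distribution)"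
    using std_normal_distribution_even_moments(2)[of 1] by (subst nn_integral_eq_integral) auto
  also have "(\<integral>y. y ^ (2 * 1) \<partial>std_normal_distribution) = 1"
    by (subst std_normal_distribution_even_moments(1)) (simp add: fact_numeral)
  finally show ?thesis .
qed

locale karhunen_loeve = prob_space M for M :: "'w measure" +
  fixes X :: "'w \<Rightarrow> 'a::{real_inner, banach, second_countable_topology}"
    and e :: "nat \<Rightarrow> 'a" and lam :: "nat \<Rightarrow> real" and Y :: "nat \<Rightarrow> 'w \<Rightarrow> real"
  assumes X_measurable [measurable]: "X \<in> borel_measurable M"
    and orthonormal: "\<And>i j. 1 \<le> i \<Longrightarrow> 1 \<le> j \<Longrightarrow> e i \<bullet> e j = (if i = j then 1 else 0)"
    and lam_pos: "\<And>i. 1 \<le> i \<Longrightarrow> 0 < lam i"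
    and lam_noninc: "\<And>i j. 1 \<le> i \<Longrightarrow> i \<le> j \<Longrightarrow> lam j \<le> lam i"
    and Y_indep: "indep_vars (\<lambda>_. borel) Y {1..}"
    and Y_normal: "\<And>i. 1 \<le> i \<Longrightarrow> distributed M lborel (Y i) std_normal_density"
    and KL_expansion:
      "(\<lambda>n. \<integral>\<^sup>+\<omega>. ennreal ((norm (X \<omega> - (\<Sum>i=1..n. (sqrt (lam i) * Y i \<omega>) *\<^sub>R e i)))\<^sup>2) \<partial>M)
         \<longlonglongrightarrow> 0"
begin

definition partial_sum :: "nat \<Rightarrow> 'w \<Rightarrow> 'a" where
  "partial_sum n \<omega> = (\<Sum>i=1..n. (sqrt (lam i) * Y i \<omega>) *\<^sub>R e i)"

lemma Y_measurable [measurable]: "1 \<le> i \<Longrightarrow> Y i \<in> borel_measurable M"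
  using distributed_measurable[OF Y_normal] by simp

lemma distr_Y: "1 \<le> i \<Longrightarrow> distr M borel (Y i) = std_normal_distribution"
  using distributed_distr_eq_density[OF Y_normal, of i] by (simp cong: distr_cong)

lemma partial_sum_measurable [measurable]: "partial_sum n \<in> borel_measurable M"
  unfolding partial_sum_def by measurable

lemma KL_approx_measurable [measurable]: "KL_approx lam Y e m p \<in> borel_measurable M"
  unfolding KL_approx_def by measurable

lemma partial_sum_tendsto:
  "(\<lambda>n. \<integral>\<^sup>+\<omega>. ennreal ((norm (X \<omega> - partial_sum n \<omega>))\<^sup>2) \<partial>M) \<longlonglongrightarrow> 0"
  using KL_expansion by (simp add: partial_sum_def)

text \<open>
Orthonormality makes the squared norm a sum over the coordinates, so one-dimensional error bounds add up. It
serves for the tails of the expansion (\<open>f\<^sub>i\<close> the identity) and for the quantization errors.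
\<close>

lemma nn_integral_norm_sum_sq:
  assumes I: "finite I" "I \<subseteq> {1..}" and [measurable]: "\<And>i. i \<in> I \<Longrightarrow> f i \<in> borel_measurable borel"
    and bound: "\<And>i. i \<in> I \<Longrightarrow> (\<integral>\<^sup>+y. ennreal ((f i y)\<^sup>2) \<partial>std_normal_distribution) \<le> ennreal (d i)"
    and d: "\<And>i. i \<in> I \<Longrightarrow> 0 \<le> d i"
  shows "(\<integral>\<^sup>+\<omega>. ennreal ((norm (\<Sum>i\<in>I. (sqrt (lam i) * f i (Y i \<omega>)) *\<^sub>R e i))\<^sup>2) \<partial>M)
    \<le> ennreal (\<Sum>i\<in>I. lam i * d i)"
proof -
  have pos: "0 \<le> lam i" "1 \<le> i" if "i \<in> I" for i
    using I that lam_pos[of i] by (auto simp: subset_iff less_imp_le)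
  have orth: "\<And>i j. i \<in> I \<Longrightarrow> j \<in> I \<Longrightarrow> e i \<bullet> e j = (if i = j then 1 else 0)"
    using orthonormal pos by blast
  have "(\<integral>\<^sup>+\<omega>. ennreal ((norm (\<Sum>i\<in>I. (sqrt (lam i) * f i (Y i \<omega>)) *\<^sub>R e i))\<^sup>2) \<partial>M)
      = (\<integral>\<^sup>+\<omega>. (\<Sum>i\<in>I. ennreal (lam i) * ennreal ((f i (Y i \<omega>))\<^sup>2)) \<partial>M)"
  proof (rule nn_integral_cong)
    fix \<omega>
    have "(norm (\<Sum>i\<in>I. (sqrt (lam i) * f i (Y i \<omega>)) *\<^sub>R e i))\<^sup>2 = (\<Sum>i\<in>I. lam i * (f i (Y i \<omega>))\<^sup>2)"
      using norm_sum_orthonormal_sq[OF I(1) orth] pos by (simp add: power_mult_distrib)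
    then show "ennreal ((norm (\<Sum>i\<in>I. (sqrt (lam i) * f i (Y i \<omega>)) *\<^sub>R e i))\<^sup>2)
        = (\<Sum>i\<in>I. ennreal (lam i) * ennreal ((f i (Y i \<omega>))\<^sup>2))"
      using pos by (simp add: sum_ennreal[symmetric] ennreal_mult)
  qed
  also have "\<dots> = (\<Sum>i\<in>I. ennreal (lam i) * (\<integral>\<^sup>+\<omega>. ennreal ((f i (Y i \<omega>))\<^sup>2) \<partial>M))"
    using pos by (subst nn_integral_sum) (auto intro!: sum.cong nn_integral_cmult)
  also have "\<dots> \<le> (\<Sum>i\<in>I. ennreal (lam i) * ennreal (d i))"
  proof (intro sum_mono mult_left_mono)
    fix i assume i: "i \<in> I"
    have "(\<integral>\<^sup>+\<omega>. ennreal ((f i (Y i \<omega>))\<^sup>2) \<partial>M) = (\<integral>\<^sup>+y. ennreal ((f i y)\<^sup>2) \<partial>distr M borel (Y i))"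
      using i pos by (subst nn_integral_distr) auto
    then show "(\<integral>\<^sup>+\<omega>. ennreal ((f i (Y i \<omega>))\<^sup>2) \<partial>M) \<le> ennreal (d i)"
      using bound[OF i] pos(2)[OF i] by (simp add: distr_Y)
  qed simp
  also have "\<dots> = ennreal (\<Sum>i\<in>I. lam i * d i)"
    using pos d by (simp add: sum_ennreal[symmetric] ennreal_mult)
  finally show ?thesis .
qed

lemma partial_sum_diff_le:
  assumes "m \<le> n"
  shows "(\<integral>\<^sup>+\<omega>. ennreal ((norm (partial_sum n \<omega> - partial_sum m \<omega>))\<^sup>2) \<partial>M) \<le> ennreal (\<Sum>i=m+1..n. lam i)"
proof -
  have "partial_sum n \<omega> - partial_sum m \<omega> = (\<Sum>i=m+1..n. (sqrt (lam i) * Y i \<omega>) *\<^sub>R e i)" for \<omega>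
  proof -
    have "{1..n} = {1..m} \<union> {m+1..n}" "{1..m} \<inter> {m+1..n} = {}" using assms by auto
    then show ?thesis unfolding partial_sum_def by (simp add: sum.union_disjoint)
  qed
  then show ?thesis
    using nn_integral_norm_sum_sq[of "{m+1..n}" "\<lambda>_ y. y" "\<lambda>_. 1"]
    by (simp add: nn_integral_std_normal_sq del: ennreal_1)
qed

text \<open>
The distance of \<open>X\<close> from the partial sum \<open>m\<close> is passed to the limit through a later partial sum \<open>n\<close>. The
factor two comes from splitting the square; it is immaterial for the rates.
\<close>

lemma partial_sum_error_le:
  assumes "\<And>n. (\<Sum>i=m+1..n. lam i) \<le> B"
  shows "(\<integral>\<^sup>+\<omega>. ennreal ((norm (X \<omega> - partial_sum m \<omega>))\<^sup>2) \<partial>M) \<le> 2 * ennreal B"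
proof -
  let ?err = "\<lambda>n. \<integral>\<^sup>+\<omega>. ennreal ((norm (X \<omega> - partial_sum n \<omega>))\<^sup>2) \<partial>M"
  have "?err m \<le> 2 * ?err n + 2 * ennreal B" if "m \<le> n" for n
  proof -
    have "?err m = (\<integral>\<^sup>+\<omega>. ennreal ((norm ((X \<omega> - partial_sum n \<omega>) + (partial_sum n \<omega> - partial_sum m \<omega>)))\<^sup>2) \<partial>M)"
      by simp
    also have "\<dots> \<le> 2 * ?err n + 2 * (\<integral>\<^sup>+\<omega>. ennreal ((norm (partial_sum n \<omega> - partial_sum m \<omega>))\<^sup>2) \<partial>M)"
      by (rule nn_integral_norm_add_sq_le) measurable
    also have "\<dots> \<le> 2 * ?err n + 2 * ennreal B"
      using partial_sum_diff_le[OF that] assms[of n]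
      by (intro add_left_mono mult_left_mono) (auto intro: order_trans ennreal_leI)
    finally show ?thesis .
  qed
  moreover have "(\<lambda>n. 2 * ?err n + 2 * ennreal B) \<longlonglongrightarrow> 2 * 0 + 2 * ennreal B"
    using partial_sum_tendsto by (intro tendsto_add ennreal_tendsto_cmult tendsto_const) auto
  ultimately show ?thesis
    by (intro tendsto_lowerbound[of "\<lambda>n. 2 * ?err n + 2 * ennreal B" _ sequentially])
       (auto intro: eventually_sequentiallyI)
qed

lemma KL_approx_error_le:
  assumes tail: "\<And>n. (\<Sum>i=m+1..n. lam i) \<le> B"
  shows "(\<integral>\<^sup>+\<omega>. ennreal ((norm (X \<omega> - KL_approx lam Y e m p \<omega>))\<^sup>2) \<partial>M)
    \<le> ennreal (4 * B + 5400 * (\<Sum>i=1..m. lam i / 2 ^ p i))"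
proof -
  have B: "0 \<le> B" using tail[of m] by simp
  have S: "0 \<le> (\<Sum>i=1..m. lam i / 2 ^ p i)" by (intro sum_nonneg divide_nonneg_nonneg) (auto simp: lam_pos less_imp_le)
  have "partial_sum m \<omega> - KL_approx lam Y e m p \<omega>
      = (\<Sum>i=1..m. (sqrt (lam i) * (Y i \<omega> - normal_approx (p i) (Y i \<omega>))) *\<^sub>R e i)" for \<omega>
    unfolding partial_sum_def KL_approx_def
    by (simp add: sum_subtractf[symmetric] scaleR_diff_left right_diff_distrib)
  then have 1: "(\<integral>\<^sup>+\<omega>. ennreal ((norm (partial_sum m \<omega> - KL_approx lam Y e m p \<omega>))\<^sup>2) \<partial>M)
      \<le> ennreal (\<Sum>i=1..m. lam i * (2700 / 2 ^ p i))"
    using nn_integral_norm_sum_sq[of "{1..m}" "\<lambda>i y. y - normal_approx (p i) y" "\<lambda>i. 2700 / 2 ^ p i"]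
      normal_approx_error_le by simp
  have "(\<integral>\<^sup>+\<omega>. ennreal ((norm (X \<omega> - KL_approx lam Y e m p \<omega>))\<^sup>2) \<partial>M)
      = (\<integral>\<^sup>+\<omega>. ennreal ((norm ((X \<omega> - partial_sum m \<omega>) + (partial_sum m \<omega> - KL_approx lam Y e m p \<omega>)))\<^sup>2) \<partial>M)"
    by simp
  also have "\<dots> \<le> 2 * (\<integral>\<^sup>+\<omega>. ennreal ((norm (X \<omega> - partial_sum m \<omega>))\<^sup>2) \<partial>M)
      + 2 * (\<integral>\<^sup>+\<omega>. ennreal ((norm (partial_sum m \<omega> - KL_approx lam Y e m p \<omega>))\<^sup>2) \<partial>M)"
    by (rule nn_integral_norm_add_sq_le) measurable
  also have "\<dots> \<le> 2 * (2 * ennreal B) + 2 * ennreal (\<Sum>i=1..m. lam i * (2700 / 2 ^ p i))"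
    by (intro add_mono mult_left_mono partial_sum_error_le tail 1) auto
  also have "(\<Sum>i=1..m. lam i * (2700 / 2 ^ p i)) = 2700 * (\<Sum>i=1..m. lam i / 2 ^ p i)"
    by (simp add: sum_distrib_left mult.commute)
  also have "2 * (2 * ennreal B) + 2 * ennreal (2700 * (\<Sum>i=1..m. lam i / 2 ^ p i))
      = ennreal 2 * (ennreal 2 * ennreal B) + ennreal 2 * ennreal (2700 * (\<Sum>i=1..m. lam i / 2 ^ p i))"
    by simp
  also have "\<dots> = ennreal (2 * (2 * B) + 2 * (2700 * (\<Sum>i=1..m. lam i / 2 ^ p i)))"
    using B S by (simp only: ennreal_mult[symmetric] ennreal_plus[symmetric] mult_nonneg_nonneg zero_le_numeral)
  finally show ?thesis by (simp add: algebra_simps)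
qed

text \<open>
\<open>X\<close> is within finite mean-square distance of a partial sum, which has a second moment itself.
\<close>

lemma law_second_moment: "distr M borel X \<in> second_moment_measures"
proof -
  have "eventually (\<lambda>n. (\<integral>\<^sup>+\<omega>. ennreal ((norm (X \<omega> - partial_sum n \<omega>))\<^sup>2) \<partial>M) < 1) sequentially"
    using partial_sum_tendsto by (rule order_tendstoD) simp
  then obtain n where n: "(\<integral>\<^sup>+\<omega>. ennreal ((norm (X \<omega> - partial_sum n \<omega>))\<^sup>2) \<partial>M) < 1"
    by (auto simp: eventually_sequentially)
  have "(\<integral>\<^sup>+\<omega>. ennreal ((norm ((X \<omega> - partial_sum n \<omega>) + partial_sum n \<omega>))\<^sup>2) \<partial>M)
     \<le> 2 * (\<integral>\<^sup>+\<omega>. ennreal ((norm (X \<omega> - partial_sum n \<omega>))\<^sup>2) \<partial>M)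
      + 2 * (\<integral>\<^sup>+\<omega>. ennreal ((norm (partial_sum n \<omega>))\<^sup>2) \<partial>M)"
    by (rule nn_integral_norm_add_sq_le) measurable
  also have "\<dots> < \<infinity>"
  proof -
    have "partial_sum 0 \<omega> = 0" for \<omega> by (simp add: partial_sum_def)
    then have "(\<integral>\<^sup>+\<omega>. ennreal ((norm (partial_sum n \<omega>))\<^sup>2) \<partial>M) < \<top>"
      using order.strict_trans1[OF partial_sum_diff_le[of 0 n] ennreal_less_top] by simp
    moreover have "(\<integral>\<^sup>+\<omega>. ennreal ((norm (X \<omega> - partial_sum n \<omega>))\<^sup>2) \<partial>M) < \<top>"
      using n by (rule less_trans) simp
    ultimately show ?thesis by (simp add: ennreal_mult_less_top)
  qed
  finally have "integrable M (\<lambda>\<omega>. (norm (X \<omega>))\<^sup>2)"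
    by (intro integrableI_nonneg) auto
  then show ?thesis
    by (simp add: second_moment_measures_def integrable_distr_eq prob_space_distr)
qed

text \<open>
The coordinates of \<open>X\<close> are those of the expansion: for all \<open>n \<ge> i\<close> the mean-square distance of the two sides is at most
that of \<open>X\<close> and the partial sum \<open>n\<close>, which tends to zero.
\<close>

lemma inner_basis:
  assumes i: "1 \<le> i"
  shows "AE \<omega> in M. X \<omega> \<bullet> e i = sqrt (lam i) * Y i \<omega>"
proof -
  let ?d = "\<integral>\<^sup>+\<omega>. ennreal ((X \<omega> \<bullet> e i - sqrt (lam i) * Y i \<omega>)\<^sup>2) \<partial>M"
  have [measurable]: "Y i \<in> borel_measurable M" using i by simp
  have "?d \<le> (\<integral>\<^sup>+\<omega>. ennreal ((norm (X \<omega> - partial_sum n \<omega>))\<^sup>2) \<partial>M)" if n: "i \<le> n" for n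
  proof (intro nn_integral_mono ennreal_leI)
    fix \<omega>
    have "partial_sum n \<omega> \<bullet> e i = (\<Sum>j=1..n. if j = i then sqrt (lam j) * Y j \<omega> else 0)"
      unfolding partial_sum_def inner_sum_left using i by (intro sum.cong) (auto simp: orthonormal)
    also have "\<dots> = sqrt (lam i) * Y i \<omega>" using i n by (simp add: sum.delta)
    finally have "X \<omega> \<bullet> e i - sqrt (lam i) * Y i \<omega> = (X \<omega> - partial_sum n \<omega>) \<bullet> e i"
      by (simp add: inner_diff_left)
    then show "(X \<omega> \<bullet> e i - sqrt (lam i) * Y i \<omega>)\<^sup>2 \<le> (norm (X \<omega> - partial_sum n \<omega>))\<^sup>2"
      using bessel_inequality[of "{i}" e "X \<omega> - partial_sum n \<omega>"] orthonormal[OF i i] by simp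
  qed
  then have "?d \<le> 0"
    using partial_sum_tendsto
    by (intro tendsto_lowerbound[of "\<lambda>n. \<integral>\<^sup>+\<omega>. ennreal ((norm (X \<omega> - partial_sum n \<omega>))\<^sup>2) \<partial>M" _ sequentially])
       (auto intro: eventually_sequentiallyI)
  then have "?d = 0" by simp
  then show ?thesis by (subst (asm) nn_integral_0_iff_AE) auto
qed

text \<open>
By Bessel's inequality, closeness of \<open>X\<close> to \<open>a\<close> forces closeness of the first \<open>n\<close> coordinates, and
each of these is \<open>sqrt (lam i) \<ge> sqrt (lam n)\<close> times a standard normal variable.
\<close>

lemma small_ball:
  assumes n: "1 \<le> n"
  shows "measure (distr M borel X) (cball a (sqrt (n * lam n / 128))) \<le> 1 / 4 ^ n"
proof -
  define b where "b i = (a \<bullet> e i) / sqrt (lam i)" for i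
  let ?A = "{\<omega>\<in>space M. (\<Sum>i=1..n. (Y i \<omega> - b i)\<^sup>2) \<le> n / 128}"
  let ?C = "cball a (sqrt (n * lam n / 128))"
  have [measurable]: "?A \<in> sets M" by measurable
  have "AE \<omega> in M. \<forall>i\<in>{1..n}. X \<omega> \<bullet> e i = sqrt (lam i) * Y i \<omega>"
    by (intro AE_finite_allI inner_basis) auto
  then have "AE \<omega> in M. \<omega> \<in> X -` ?C \<inter> space M \<longrightarrow> \<omega> \<in> ?A"
  proof eventually_elim
    case (elim \<omega>)
    show ?case
    proof
      assume \<omega>: "\<omega> \<in> X -` ?C \<inter> space M"
      have pos: "0 < lam n" using n by (rule lam_pos)
      have "lam n * (\<Sum>i=1..n. (Y i \<omega> - b i)\<^sup>2) = (\<Sum>i=1..n. lam n * (Y i \<omega> - b i)\<^sup>2)"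
        by (rule sum_distrib_left)
      also have "\<dots> \<le> (\<Sum>i=1..n. ((X \<omega> - a) \<bullet> e i)\<^sup>2)"
      proof (rule sum_mono)
        fix i assume i: "i \<in> {1..n}"
        have "lam n * (Y i \<omega> - b i)\<^sup>2 \<le> lam i * (Y i \<omega> - b i)\<^sup>2"
          using i lam_noninc[of i n] by (intro mult_right_mono) auto
        also have "\<dots> = (sqrt (lam i) * (Y i \<omega> - b i))\<^sup>2"
          using i lam_pos[of i] by (simp add: power_mult_distrib)
        also have "sqrt (lam i) * (Y i \<omega> - b i) = (X \<omega> - a) \<bullet> e i"
          using i lam_pos[of i] elim by (simp add: b_def right_diff_distrib inner_diff_left)
        finally show "lam n * (Y i \<omega> - b i)\<^sup>2 \<le> ((X \<omega> - a) \<bullet> e i)\<^sup>2" .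
      qed
      also have "\<dots> \<le> (norm (X \<omega> - a))\<^sup>2"
        by (intro bessel_inequality) (auto simp: orthonormal)
      also have "\<dots> \<le> (sqrt (n * lam n / 128))\<^sup>2"
        using \<omega> by (intro power_mono) (auto simp: dist_norm norm_minus_commute)
      also have "\<dots> = lam n * (n / 128)" using pos by simp
      finally show "\<omega> \<in> ?A" using \<omega> pos by (simp add: mult_le_cancel_left_pos)
    qed
  qed
  then have "emeasure M (X -` ?C \<inter> space M) \<le> emeasure M ?A"
    by (intro emeasure_mono_AE) auto
  also have "\<dots> \<le> ennreal (1 / 4 ^ n)"
    using Y_normal by (intro std_normal_small_ball indep_vars_subset[OF Y_indep]) auto
  finally show ?thesis
    by (subst measure_distr) (auto simp: measure_def intro: enn2real_leI)
qed

lemma quant_ge: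
  assumes "1 \<le> p"
  shows "sqrt (p * lam p / 256) \<le> quant (distr M borel X) p"
  using quant_ge_of_small_balls[OF law_second_moment assms _ small_ball[OF assms]] lam_pos[OF assms]
  by simp

text \<open>
The approximation is a function \<open>g\<close> of the numbers \<open>K\<close> of the cells that contain the variables
\<open>std_normal_cdf (Y i)\<close>. These numbers are independent and uniform on \<open>2 ^ p i\<close> values each, so their vector
is uniform on a set of \<open>2\<close> to the power \<open>total_bits m p\<close> elements.
\<close>

lemma KL_approx_in_random_bit_measures:
  "distr M borel (KL_approx lam Y e m p) \<in> random_bit_measures (total_bits m p)"
proof -
  define S where "S = (\<Pi>\<^sub>E i\<in>{1..m}. {..<(2::nat) ^ p i})"
  define K where "K \<omega> = (\<lambda>i\<in>{1..m}. nat \<lfloor>2 ^ p i * std_normal_cdf (Y i \<omega>)\<rfloor>)" for \<omega>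
  define g where "g k = (\<Sum>i=1..m. (sqrt (lam i) *
    inv std_normal_cdf (real (k i) / 2 ^ p i + 1 / 2 ^ (p i + 1))) *\<^sub>R e i)" for k :: "nat \<Rightarrow> nat"
  define A where "A s i = {y. \<lfloor>2 ^ p i * std_normal_cdf y\<rfloor> = int (s i)}" for s :: "nat \<Rightarrow> nat" and i
  have [measurable]: "A s i \<in> sets borel" for s i unfolding A_def by measurable
  have cell: "0 \<le> \<lfloor>2 ^ p i * std_normal_cdf y\<rfloor>" "nat \<lfloor>2 ^ p i * std_normal_cdf y\<rfloor> < 2 ^ p i" for i y
  proof -
    show 0: "0 \<le> \<lfloor>2 ^ p i * std_normal_cdf y\<rfloor>" using std_normal_cdf_bounds[of y] by simp
    have "2 ^ p i * std_normal_cdf y < real_of_int (2 ^ p i)" using std_normal_cdf_bounds[of y] by simp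
    then have "\<lfloor>2 ^ p i * std_normal_cdf y\<rfloor> < 2 ^ p i" by (simp only: floor_less_iff)
    then show "nat \<lfloor>2 ^ p i * std_normal_cdf y\<rfloor> < 2 ^ p i" using 0 by (simp add: nat_less_iff)
  qed
  have "finite S" unfolding S_def by (intro finite_PiE) auto
  have "card S = 2 ^ total_bits m p"
    by (simp add: S_def card_PiE total_bits_def power_sum)
  have K_S: "K \<omega> \<in> S" for \<omega>
    unfolding K_def S_def using cell(2) by auto
  have vimage: "K -` {s} \<inter> space M = {\<omega>\<in>space M. \<forall>i\<in>{1..m}. Y i \<omega> \<in> A s i}" if s: "s \<in> S" for s
  proof -
    have "K \<omega> = s \<longleftrightarrow> (\<forall>i\<in>{1..m}. nat \<lfloor>2 ^ p i * std_normal_cdf (Y i \<omega>)\<rfloor> = s i)" for \<omega>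
    proof
      assume *: "\<forall>i\<in>{1..m}. nat \<lfloor>2 ^ p i * std_normal_cdf (Y i \<omega>)\<rfloor> = s i"
      show "K \<omega> = s"
        by (rule PiE_ext[OF K_S[unfolded S_def] s[unfolded S_def]]) (use * in \<open>simp add: K_def\<close>)
    qed (auto simp: K_def)
    moreover have "nat \<lfloor>2 ^ p i * std_normal_cdf y\<rfloor> = k \<longleftrightarrow> \<lfloor>2 ^ p i * std_normal_cdf y\<rfloor> = int k" for i y k
      using cell(1)[of i y] by auto
    ultimately show ?thesis by (auto simp: A_def)
  qed
  have meas: "K \<in> measurable M (count_space S)"
    unfolding measurable_count_space_eq2[OF \<open>finite S\<close>]
  proof (intro conjI ballI)
    show "K \<in> space M \<rightarrow> S" using K_S by auto
    fix s assume "s \<in> S"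
    show "K -` {s} \<inter> space M \<in> sets M" unfolding vimage[OF \<open>s \<in> S\<close>] by measurable
  qed
  have unif: "emeasure M (K -` {s} \<inter> space M) = ennreal (1 / 2 ^ total_bits m p)" if s: "s \<in> S" for s
  proof (cases "m = 0")
    case True
    then show ?thesis using vimage[OF s] by (simp add: total_bits_def emeasure_space_1)
  next
    case False
    then have ne: "{1..m} \<noteq> {}" by simp
    have cells: "prob (Y i -` A s i \<inter> space M) = 1 / 2 ^ p i" if i: "i \<in> {1..m}" for i
    proof -
      have "s i < 2 ^ p i" using s i by (auto simp: S_def)
      have "prob (Y i -` A s i \<inter> space M) = measure (distr M borel (Y i)) (A s i)"
        using i by (subst measure_distr) auto
      also have "\<dots> = 1 / 2 ^ p i"
        using i cell_probability[OF \<open>s i < 2 ^ p i\<close>] by (simp add: distr_Y measure_def A_def)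
      finally show ?thesis .
    qed
    have "K -` {s} \<inter> space M = (\<Inter>i\<in>{1..m}. Y i -` A s i \<inter> space M)"
      unfolding vimage[OF s] using ne by auto
    then have "prob (K -` {s} \<inter> space M) = (\<Prod>i\<in>{1..m}. prob (Y i -` A s i \<inter> space M))"
      using ne by (simp only:) (intro indep_varsD[OF Y_indep], auto)
    also have "\<dots> = (\<Prod>i\<in>{1..m}. 1 / 2 ^ p i)"
      by (intro prod.cong refl cells)
    also have "\<dots> = 1 / 2 ^ total_bits m p"
      by (simp add: prod_dividef power_sum total_bits_def)
    finally show ?thesis by (simp add: emeasure_eq_measure)
  qed
  have "KL_approx lam Y e m p \<omega> = g (K \<omega>)" for \<omega>
    unfolding KL_approx_def g_def
  proof (intro sum.cong refl)
    fix i assume "i \<in> {1..m}"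
    then have "real (K \<omega> i) = real_of_int \<lfloor>2 ^ p i * std_normal_cdf (Y i \<omega>)\<rfloor>"
      using cell(1)[of i "Y i \<omega>"] by (simp add: K_def)
    then show "(sqrt (lam i) * normal_approx (p i) (Y i \<omega>)) *\<^sub>R e i = (sqrt (lam i) *
      inv std_normal_cdf (real (K \<omega> i) / 2 ^ p i + 1 / 2 ^ (p i + 1))) *\<^sub>R e i"
      by (simp add: normal_approx_def cell_midpoint_def)
  qed
  then have "KL_approx lam Y e m p = (\<lambda>\<omega>. g (K \<omega>))" by blast
  then show ?thesis
    using distr_uniform_in_random_bit_measures[OF \<open>finite S\<close> \<open>card S = 2 ^ total_bits m p\<close> meas unif, of g] by simp
qed

lemma rbit_le_KL_approx_error:
  "rbit (distr M borel X) (total_bits m p) \<le> sqrt (\<integral>\<omega>. (norm (X \<omega> - KL_approx lam Y e m p \<omega>))\<^sup>2 \<partial>M)"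
  by (intro rbit_le_coupling prob_space_axioms law_second_moment KL_approx_in_random_bit_measures) measurable

section \<open>Rates under regular variation\<close>

text \<open>
Arbitrary bit numbers \<open>q\<close> above the prescribed ones are admitted, so that surplus bits can be spent when
a given total has to be attained exactly.
\<close>

lemma KL_approx_error_le_power_log:
  assumes \<beta>: "1 < \<beta>" and C: "0 < C" "\<And>i. 1 \<le> i \<Longrightarrow> lam i \<le> C * power_log \<beta> \<alpha> i"
  obtains D where "0 < D" and "\<And>m q. 1 \<le> m \<Longrightarrow> (\<And>i. i \<in> {1..m} \<Longrightarrow> bit_number \<alpha> \<beta> m i \<le> q i) \<Longrightarrow>
    sqrt (\<integral>\<omega>. (norm (X \<omega> - KL_approx lam Y e m q \<omega>))\<^sup>2 \<partial>M) \<le> D * sqrt (power_log (\<beta> - 1) \<alpha> m)"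
proof -
  obtain T where T: "0 < T" "\<And>m n. 1 \<le> m \<Longrightarrow> (\<Sum>i=m+1..n. power_log \<beta> \<alpha> i) \<le> T * power_log (\<beta> - 1) \<alpha> m"
    using sum_power_log_tail_le[OF \<beta>, of \<alpha>] by blast
  define D where "D = 4 * (C * T) + 5400 * C"
  have D: "0 < D" using C T by (simp add: D_def add_pos_pos)
  have "sqrt (\<integral>\<omega>. (norm (X \<omega> - KL_approx lam Y e m q \<omega>))\<^sup>2 \<partial>M) \<le> sqrt D * sqrt (power_log (\<beta> - 1) \<alpha> m)"
    if m: "1 \<le> m" and q: "\<And>i. i \<in> {1..m} \<Longrightarrow> bit_number \<alpha> \<beta> m i \<le> q i" for m q
  proof -
    let ?G = "power_log (\<beta> - 1) \<alpha> m"
    have tail: "(\<Sum>i=m+1..n. lam i) \<le> C * (T * ?G)" for n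
    proof -
      have "(\<Sum>i=m+1..n. lam i) \<le> (\<Sum>i=m+1..n. C * power_log \<beta> \<alpha> i)"
        by (intro sum_mono C) simp
      also have "\<dots> \<le> C * (T * ?G)"
        unfolding sum_distrib_left[symmetric] using C(1) by (intro mult_left_mono T(2) m) simp
      finally show ?thesis .
    qed
    have "(\<Sum>i=1..m. lam i / 2 ^ q i) \<le> (\<Sum>i=1..m. C * power_log \<beta> \<alpha> m)"
    proof (rule sum_mono)
      fix i assume i: "i \<in> {1..m}"
      have "lam i / 2 ^ q i \<le> C * power_log \<beta> \<alpha> i / 2 ^ bit_number \<alpha> \<beta> m i"
        using C i q[OF i] lam_pos[of i] power_log_pos[of i \<beta> \<alpha>]
        by (intro frac_le) (auto intro: less_imp_le)
      also have "\<dots> \<le> C * power_log \<beta> \<alpha> m"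
        using C(1) i power_log_div_bits_le[of i m \<beta> \<alpha>] by (simp flip: times_divide_eq_right)
      finally show "lam i / 2 ^ q i \<le> C * power_log \<beta> \<alpha> m" .
    qed
    also have "\<dots> = C * ?G"
      using real_mult_power_log[OF m, of \<beta> \<alpha>] by simp
    finally have quantized: "(\<Sum>i=1..m. lam i / 2 ^ q i) \<le> C * ?G" .
    have "(\<integral>\<^sup>+\<omega>. ennreal ((norm (X \<omega> - KL_approx lam Y e m q \<omega>))\<^sup>2) \<partial>M)
        \<le> ennreal (4 * (C * (T * ?G)) + 5400 * (\<Sum>i=1..m. lam i / 2 ^ q i))"
      by (rule KL_approx_error_le[OF tail])
    also have "\<dots> \<le> ennreal (D * ?G)"
      using quantized by (intro ennreal_leI) (simp add: D_def algebra_simps)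
    finally have "(\<integral>\<omega>. (norm (X \<omega> - KL_approx lam Y e m q \<omega>))\<^sup>2 \<partial>M) \<le> D * ?G"
      using D power_log_pos[OF m, of "\<beta> - 1" \<alpha>]
      by (subst integral_eq_nn_integral) (auto intro!: enn2real_leI)
    then show ?thesis by (simp flip: real_sqrt_mult)
  qed
  then show thesis using that[of "sqrt D"] D by simp
qed

text \<open>
For given \<open>p\<close> the dimension \<open>m\<close> is the largest for which the linear bound \<open>K m\<close> on the number of bits does not
exceed \<open>p\<close>. It is comparable to \<open>p\<close>, hence so are the rates at \<open>m\<close> and at \<open>p\<close>.
\<close>

lemma rbit_le_power_log:
  assumes \<beta>: "1 < \<beta>" and C: "0 < C" "\<And>i. 1 \<le> i \<Longrightarrow> lam i \<le> C * power_log \<beta> \<alpha> i"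
  obtains D where "0 < D"
    and "\<And>p. 1 \<le> p \<Longrightarrow> rbit (distr M borel X) p \<le> D * sqrt (power_log (\<beta> - 1) \<alpha> p)"
proof -
  obtain D where D: "0 < D" "\<And>m q. 1 \<le> m \<Longrightarrow> (\<And>i. i \<in> {1..m} \<Longrightarrow> bit_number \<alpha> \<beta> m i \<le> q i) \<Longrightarrow>
    sqrt (\<integral>\<omega>. (norm (X \<omega> - KL_approx lam Y e m q \<omega>))\<^sup>2 \<partial>M) \<le> D * sqrt (power_log (\<beta> - 1) \<alpha> m)"
    using KL_approx_error_le_power_log[OF \<beta> C] by blast
  define K where "K = nat \<lceil>2 * (\<beta> + max \<alpha> 0) + 2\<rceil>"
  have K: "2 * (\<beta> + max \<alpha> 0) + 2 \<le> real K" unfolding K_def by linarith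
  have "0 < K" using K \<beta> by (cases "K = 0") auto
  define F where "F = (2 * real K) powr (\<beta> - 1 + \<bar>\<alpha>\<bar>)"
  have "rbit (distr M borel X) p \<le> (D * sqrt F) * sqrt (power_log (\<beta> - 1) \<alpha> p)" if p: "1 \<le> p" for p
  proof -
    \<comment> \<open>for \<open>p < K\<close> dimension one is used; it requires a single bit\<close>
    define m where "m = max 1 (p div K)"
    have m: "1 \<le> m" by (simp add: m_def)
    have "p < K * (p div K + 1)"
      using \<open>0 < K\<close> by (metis add.commute dividend_less_times_div mult_Suc_right plus_1_eq_Suc)
    also have "\<dots> \<le> K * (2 * m)" by (intro mult_left_mono) (auto simp: m_def)
    finally have "real p \<le> real (K * (2 * m))" by (intro of_nat_mono less_imp_le)
    then have pm: "real p \<le> 2 * real K * real m" by simp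
    let ?b = "bit_number \<alpha> \<beta> m"
    have total: "total_bits m ?b \<le> p"
    proof (cases "p div K = 0")
      case True
      then have "m = 1" by (simp add: m_def)
      then show ?thesis using p by (simp add: total_bits_def bit_number_def bit_budget_def)
    next
      case False
      then have "m = p div K" by (simp add: m_def)
      then have "K * m \<le> p" by simp
      have "real (total_bits m ?b) \<le> (2 * (\<beta> + max \<alpha> 0) + 2) * real m"
        using \<beta> m by (rule total_bits_le)
      also have "\<dots> \<le> real K * real m" using K by (intro mult_right_mono) auto
      also have "\<dots> \<le> real p" using \<open>K * m \<le> p\<close> by (metis of_nat_le_iff of_nat_mult)
      finally show ?thesis by simp
    qed
    \<comment> \<open>the first coordinate receives the surplus bits\<close>
    define q where "q i = ?b i + (if i = 1 then p - total_bits m ?b else 0)" for i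
    have "total_bits m q = total_bits m ?b + (\<Sum>i=1..m. if i = 1 then p - total_bits m ?b else 0)"
      by (simp add: total_bits_def q_def sum.distrib)
    also have "\<dots> = p" using m total by (simp add: sum.delta)
    finally have "rbit (distr M borel X) p \<le> sqrt (\<integral>\<omega>. (norm (X \<omega> - KL_approx lam Y e m q \<omega>))\<^sup>2 \<partial>M)"
      using rbit_le_KL_approx_error[of m q] by simp
    also have "\<dots> \<le> D * sqrt (power_log (\<beta> - 1) \<alpha> m)"
      by (rule D(2)[OF m]) (simp add: q_def)
    also have "power_log (\<beta> - 1) \<alpha> m \<le> F * power_log (\<beta> - 1) \<alpha> p"
    proof -
      have "m \<le> p" using p \<open>0 < K\<close> by (simp add: m_def)
      then show ?thesis unfolding F_def using \<beta> m pm by (intro power_log_le_of_comparable) auto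
    qed
    finally show ?thesis using D(1) by (simp add: real_sqrt_mult)
  qed
  moreover have "0 < D * sqrt F" using D \<open>0 < K\<close> by (simp add: F_def)
  ultimately show thesis using that by blast
qed

lemma quant_ge_power_log:
  assumes c: "0 < c" "\<And>i. 1 \<le> i \<Longrightarrow> c * power_log \<beta> \<alpha> i \<le> lam i" and p: "1 \<le> p"
  shows "sqrt (c / 256) * sqrt (power_log (\<beta> - 1) \<alpha> p) \<le> quant (distr M borel X) p"
proof -
  have "c * power_log (\<beta> - 1) \<alpha> p = p * (c * power_log \<beta> \<alpha> p)"
    using real_mult_power_log[OF p, of \<beta> \<alpha>] by (simp add: mult.left_commute)
  also have "\<dots> \<le> p * lam p" by (intro mult_left_mono c p) simp
  finally have "sqrt (c * power_log (\<beta> - 1) \<alpha> p / 256) \<le> sqrt (p * lam p / 256)" by simp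
  also have "\<dots> \<le> quant (distr M borel X) p" by (rule quant_ge[OF p])
  finally show ?thesis by (simp flip: real_sqrt_mult)
qed

end

theorem theorem3:
  fixes M :: "'w measure"
    and X :: "'w \<Rightarrow> 'a::{real_inner, banach, second_countable_topology}"
    and \<mu> :: "'a measure"
    and e :: "nat \<Rightarrow> 'a"
    and lam :: "nat \<Rightarrow> real"
    and Y :: "nat \<Rightarrow> 'w \<Rightarrow> real"
    and \<alpha> \<beta> L :: real
  assumes prob: "prob_space M"
    and gaussian: "centered_gaussian_element M X"
    and law: "\<mu> = distr M borel X"
    and infdim: "infinite_dimensional (measure_support \<mu>)"
    and orthonormal: "\<forall>i\<ge>1. \<forall>j\<ge>1. e i \<bullet> e j = (if i = j then 1 else 0)"
    and lam_pos: "\<forall>i\<ge>1. 0 < lam i"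
    and lam_noninc: "\<forall>i\<ge>1. \<forall>j\<ge>i. lam j \<le> lam i"
    and lam_summable: "lam summable_on {1..}"
    and Y_indep: "prob_space.indep_vars M (\<lambda>_. borel) Y {1..}"
    and Y_normal: "\<forall>i\<ge>1. distributed M lborel (Y i) std_normal_density"
    and KL_expansion:
      "(\<lambda>n. \<integral>\<^sup>+\<omega>. ennreal ((norm (X \<omega> - (\<Sum>i=1..n. (sqrt (lam i) * Y i \<omega>) *\<^sub>R e i)))\<^sup>2) \<partial>M)
         \<longlonglongrightarrow> 0"
    and beta: "\<beta> > 1"
    and lam_limit: "(\<lambda>i. lam i * real i powr \<beta> * ln (real i) powr \<alpha>) \<longlonglongrightarrow> L"
    and L_pos: "0 < L"
  shows "weakly_equiv_on {1..} (\<lambda>p. rbit \<mu> p) (\<lambda>p. quant \<mu> p) \<and>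
    weakly_equiv_on {1..} (\<lambda>p. quant \<mu> p)
      (\<lambda>p. real p powr (- (\<beta> - 1) / 2) * ln (real p + 1) powr (- \<alpha> / 2)) \<and>
    weakly_equiv_on {1..}
      (\<lambda>m. sqrt (\<integral>\<omega>. (norm (X \<omega> - KL_approx lam Y e m (bit_number \<alpha> \<beta> m) \<omega>))\<^sup>2 \<partial>M))
      (\<lambda>m. rbit \<mu> (total_bits m (bit_number \<alpha> \<beta> m))) \<and>
    weakly_equiv_on {1..} (\<lambda>m. real (total_bits m (bit_number \<alpha> \<beta> m))) (\<lambda>m. real m)"
proof -
  interpret KL: karhunen_loeve M X e lam Y
  proof (intro karhunen_loeve.intro karhunen_loeve_axioms.intro)
    show "prob_space M" by (rule prob)
    show "X \<in> borel_measurable M"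
      using gaussian by (simp only: centered_gaussian_element_def)
    show "prob_space.indep_vars M (\<lambda>_. borel) Y {1..}" by (rule Y_indep)
    show "e i \<bullet> e j = (if i = j then 1 else 0)" if "1 \<le> i" "1 \<le> j" for i j
      using orthonormal that by simp
    show "0 < lam i" if "1 \<le> i" for i using lam_pos that by simp
    show "lam j \<le> lam i" if "1 \<le> i" "i \<le> j" for i j using lam_noninc that by simp
    show "distributed M lborel (Y i) std_normal_density" if "1 \<le> i" for i
      by (rule Y_normal[rule_format, OF that])
    show "(\<lambda>n. \<integral>\<^sup>+\<omega>. ennreal ((norm (X \<omega> - (\<Sum>i=1..n. (sqrt (lam i) * Y i \<omega>) *\<^sub>R e i)))\<^sup>2) \<partial>M)
         \<longlonglongrightarrow> 0" by (rule KL_expansion)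
  qed
  let ?g = "\<lambda>p. sqrt (power_log (\<beta> - 1) \<alpha> p)"
  let ?total = "\<lambda>m. total_bits m (bit_number \<alpha> \<beta> m)"
  let ?err = "\<lambda>m. sqrt (\<integral>\<omega>. (norm (X \<omega> - KL_approx lam Y e m (bit_number \<alpha> \<beta> m) \<omega>))\<^sup>2 \<partial>M)"
  obtain c C where "0 < c" "0 < C" and lam_ge: "\<And>i. 1 \<le> i \<Longrightarrow> c * power_log \<beta> \<alpha> i \<le> lam i"
    and lam_le: "\<And>i. 1 \<le> i \<Longrightarrow> lam i \<le> C * power_log \<beta> \<alpha> i"
    by (rule power_log_bounds_of_tendsto[OF lam_limit L_pos KL.lam_pos]) (assumption, rule that)
  note c = \<open>0 < c\<close> lam_ge and C = \<open>0 < C\<close> lam_le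
  obtain D where D: "0 < D" "\<And>p. 1 \<le> p \<Longrightarrow> rbit \<mu> p \<le> D * ?g p"
    by (rule KL.rbit_le_power_log[OF beta C, folded law]) (assumption, rule that)
  obtain E where E: "0 < E" "\<And>m. 1 \<le> m \<Longrightarrow> ?err m \<le> E * ?g m"
  proof (rule KL.KL_approx_error_le_power_log[OF beta C])
    fix E assume "0 < E" and *: "\<And>m q. 1 \<le> m \<Longrightarrow> (\<And>i. i \<in> {1..m} \<Longrightarrow> bit_number \<alpha> \<beta> m i \<le> q i) \<Longrightarrow>
      sqrt (\<integral>\<omega>. (norm (X \<omega> - KL_approx lam Y e m q \<omega>))\<^sup>2 \<partial>M) \<le> E * ?g m"
    show thesis
    proof (rule that[OF \<open>0 < E\<close>])
      show "?err m \<le> E * ?g m" if "1 \<le> m" for m by (rule *[OF that]) simp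
    qed
  qed
  define d where "d = sqrt (c / 256)"
  have d: "0 < d" "\<And>p. 1 \<le> p \<Longrightarrow> d * ?g p \<le> quant \<mu> p"
    using c(1) KL.quant_ge_power_log[OF c] by (simp_all add: d_def law)
  have quant_rbit: "quant \<mu> p \<le> rbit \<mu> p" for p
    unfolding law by (rule quant_le_rbit[OF KL.law_second_moment])
  have g_le: "?g p \<le> 1 / d * quant \<mu> p" if "1 \<le> p" for p
    using d(2)[OF that] d(1) by (simp add: field_simps)
  have "rbit \<mu> p \<le> D / d * quant \<mu> p" if "1 \<le> p" for p
    using D(2)[OF that] mult_left_mono[OF g_le[OF that], of D] D(1) by simp
  then have 1: "weakly_equiv_on {1..} (\<lambda>p. rbit \<mu> p) (\<lambda>p. quant \<mu> p)"
    unfolding weakly_equiv_on_def dominated_on_def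
    using quant_rbit D(1) d(1) by (intro conjI exI[of _ "D / d"] exI[of _ 1]) auto
  have "quant \<mu> p \<le> D * ?g p" if "1 \<le> p" for p
    using quant_rbit[of p] D(2)[OF that] by linarith
  then have 2: "weakly_equiv_on {1..} (\<lambda>p. quant \<mu> p) ?g"
    unfolding weakly_equiv_on_def dominated_on_def
    using g_le D(1) d(1) by (intro conjI exI[of _ D] exI[of _ "1 / d"]) auto
  define K where "K = 2 * (\<beta> + max \<alpha> 0) + 2"
  have K: "0 < K" using beta by (simp add: K_def)
  have total: "m \<le> ?total m" for m by (rule total_bits_ge)
  have total_le: "real (?total m) \<le> K * real m" if "1 \<le> m" for m
    unfolding K_def using beta that by (rule total_bits_le)
  define F where "F = sqrt (K powr (\<beta> - 1 + \<bar>\<alpha>\<bar>))"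
  have F: "0 < F" using K by (simp add: F_def)
  have "?err m \<le> E * F / d * rbit \<mu> (?total m)" if m: "1 \<le> m" for m
  proof -
    have "?g m \<le> F * ?g (?total m)"
      unfolding F_def real_sqrt_mult[symmetric] using beta m total total_le
      by (intro real_sqrt_le_mono power_log_le_of_comparable) auto
    also have "\<dots> \<le> F * (1 / d * rbit \<mu> (?total m))"
    proof (intro mult_left_mono)
      have "1 \<le> ?total m" using m total[of m] by linarith
      then have "?g (?total m) \<le> 1 / d * quant \<mu> (?total m)" by (rule g_le)
      also have "\<dots> \<le> 1 / d * rbit \<mu> (?total m)"
        using d(1) by (intro mult_left_mono quant_rbit) simp
      finally show "?g (?total m) \<le> 1 / d * rbit \<mu> (?total m)" .
    qed (use F in simp)
    finally have "E * ?g m \<le> E * (F * (1 / d * rbit \<mu> (?total m)))"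
      using E(1) by (intro mult_left_mono) auto
    with E(2)[OF m] show ?thesis by simp
  qed
  moreover have "rbit \<mu> (?total m) \<le> 1 * ?err m" for m
    unfolding law using KL.rbit_le_KL_approx_error by simp
  ultimately have 3: "weakly_equiv_on {1..} ?err (\<lambda>m. rbit \<mu> (?total m))"
    unfolding weakly_equiv_on_def dominated_on_def
    using E(1) F d(1) by (intro conjI exI[of _ "E * F / d"] exI[of _ 1]) auto
  have 4: "weakly_equiv_on {1..} (\<lambda>m. real (?total m)) (\<lambda>m. real m)"
    unfolding weakly_equiv_on_def dominated_on_def
    using K total total_le by (intro conjI exI[of _ K] exI[of _ 1]) auto
  show ?thesis
    using 1 2 3 4 by (simp add: sqrt_power_log)
qed

end
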